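(* Let $G$ be a finite simple graph such that every chordless (induced) cycle of $G$ has length $3$ or $5$. Then the independence complex $I(G)$ is vertex decomposable; hence $I(G)$ is shellable and sequentially Cohen-Macaulay.
   Context: The independence complex $I(G)$ of a graph $G=(V,E)$ is the simplicial complex on vertex set $V$ whose faces are the independent sets of $G$. A chordless cycle of length $n$ is an induced subgraph isomorphic to the $n$-cycle $C_n$. A simplicial complex $\Delta$ is vertex decomposable if it is a simplex (including the empty complex $\{\emptyset\}$), or else has a vertex $v$ such that (1) both $\Delta\setminus v$ (faces not containing $v$) and $\operatorname{link}_\Delta v=\{F: F\cup\{v\}\in\Delta, v\notin F\}$ are vertex decomposable, and (2) no face of $\operatorname{link}_\Delta v$ is a facet of $\Delta\setminus v$. A complex is sequentially Cohen-Macaulay if, for every $i$, the subcomplex generated by its $i$-dimensional faces is Cohen-Macaulay. *)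

theory Defs
  imports
    Complex_Main
    "Graph_Theory.Pair_Digraph"
    "Graph_Theory.Digraph_Isomorphism"
begin

section \<open>Graphs\<close>

text \<open>
  A finite simple graph is a \<^locale>\<open>pair_graph\<close>: a finite vertex set together with
  a symmetric loop-free set of ordered pairs, every edge contributing both of its orientations.
\<close>

definition cycle_graph :: "nat \<Rightarrow> nat pair_pre_digraph" where
  "cycle_graph n = \<lparr> pverts = {..<n},
     parcs = {(i, j). i < n \<and> j < n \<and> (j = Suc i mod n \<or> i = Suc j mod n)} \<rparr>"

definition chordless_cycle :: "'a pair_pre_digraph \<Rightarrow> 'a set \<Rightarrow> nat \<Rightarrow> bool" where
  "chordless_cycle G W n \<longleftrightarrow> 3 \<le> n \<and> W \<subseteq> pverts G \<and>
     digraph_iso (with_proj G \<restriction> W) (with_proj (cycle_graph n))"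

definition independent_set :: "'a pair_pre_digraph \<Rightarrow> 'a set \<Rightarrow> bool" where
  "independent_set G S \<longleftrightarrow> S \<subseteq> pverts G \<and> (\<forall>u\<in>S. \<forall>v\<in>S. (u, v) \<notin> parcs G)"

definition independence_complex :: "'a pair_pre_digraph \<Rightarrow> 'a set set" where
  "independence_complex G = {S. independent_set G S}"

section \<open>Simplicial complexes\<close>

text \<open>
  A complex is the set of its faces and always contains the empty face; in particular the
  complex \<open>{{}}\<close> is allowed, but the void complex \<open>{}\<close> is not.
\<close>

definition simplicial_complex :: "'a set set \<Rightarrow> bool" where
  "simplicial_complex \<Delta> \<longleftrightarrow> finite \<Delta> \<and> \<Delta> \<noteq> {} \<and> (\<forall>F\<in>\<Delta>. finite F \<and> Pow F \<subseteq> \<Delta>)"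

definition face_dim :: "'a set \<Rightarrow> int" where
  "face_dim F = int (card F) - 1"

definition complex_dim :: "'a set set \<Rightarrow> int" where
  "complex_dim \<Delta> = Max (face_dim ` \<Delta>)"

definition facets :: "'a set set \<Rightarrow> 'a set set" where
  "facets \<Delta> = {F \<in> \<Delta>. \<forall>G\<in>\<Delta>. F \<subseteq> G \<longrightarrow> F = G}"

definition deletion :: "'a set set \<Rightarrow> 'a \<Rightarrow> 'a set set" where
  "deletion \<Delta> v = {F \<in> \<Delta>. v \<notin> F}"

definition link :: "'a set set \<Rightarrow> 'a set \<Rightarrow> 'a set set" where
  "link \<Delta> F = {G. G \<inter> F = {} \<and> G \<union> F \<in> \<Delta>}"

definition generated_complex :: "'a set set \<Rightarrow> 'a set set" where
  "generated_complex \<F> = {F. \<exists>G\<in>\<F>. F \<subseteq> G}"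

section \<open>Vertex decomposability and shellability\<close>

inductive vertex_decomposable :: "'a set set \<Rightarrow> bool" where
  simplex: "finite S \<Longrightarrow> vertex_decomposable (Pow S)"
| shedding: "\<lbrakk>simplicial_complex \<Delta>; {v} \<in> \<Delta>;
      vertex_decomposable (deletion \<Delta> v); vertex_decomposable (link \<Delta> {v});
      link \<Delta> {v} \<inter> facets (deletion \<Delta> v) = {}\<rbrakk>
    \<Longrightarrow> vertex_decomposable \<Delta>"

definition pure_of_dim :: "'a set set \<Rightarrow> int \<Rightarrow> bool" where
  "pure_of_dim \<Delta> d \<longleftrightarrow> (\<forall>F\<in>facets \<Delta>. face_dim F = d)"

text \<open>
  Shellability is meant in the nonpure sense of Bjoerner and Wachs: facets may have different dimensions.
\<close>

definition shelling :: "'a set set \<Rightarrow> 'a set list \<Rightarrow> bool" where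
  "shelling \<Delta> Fs \<longleftrightarrow> distinct Fs \<and> set Fs = facets \<Delta> \<and>
     (\<forall>j. 0 < j \<and> j < length Fs \<longrightarrow>
        pure_of_dim (generated_complex {Fs ! i |i. i < j} \<inter> Pow (Fs ! j)) (face_dim (Fs ! j) - 1))"

definition shellable :: "'a set set \<Rightarrow> bool" where
  "shellable \<Delta> \<longleftrightarrow> (\<exists>Fs. shelling \<Delta> Fs)"

section \<open>Reduced simplicial homology\<close>

text \<open>
  A chain is identified with its function of coefficients on faces.  Faces are oriented by an
  injective numbering \<open>ord\<close> of the vertices: \<open>\<partial>[v\<^sub>0,\<dots>,v\<^sub>p] = \<Sum>\<^sub>i (-1)\<^sup>i [v\<^sub>0,\<dots>,(omit v\<^sub>i),\<dots>,v\<^sub>p]\<close>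
  for \<open>ord v\<^sub>0 < \<dots> < ord v\<^sub>p\<close>.  Accordingly the coefficient of \<open>\<partial>c\<close> at \<open>F\<close> is the sum of
  the signed coefficients of \<open>c\<close> at the faces \<open>insert v F\<close>.
  The empty face spans the chains of dimension \<open>-1\<close>, so the homology is reduced.
\<close>

definition chains :: "'a set set \<Rightarrow> int \<Rightarrow> ('a set \<Rightarrow> 'k::field) set" where
  "chains \<Delta> p = {c. \<forall>F. c F \<noteq> 0 \<longrightarrow> F \<in> \<Delta> \<and> face_dim F = p}"

definition boundary :: "('a \<Rightarrow> nat) \<Rightarrow> 'a set set \<Rightarrow> ('a set \<Rightarrow> 'k::field) \<Rightarrow> 'a set \<Rightarrow> 'k" where
  "boundary ord \<Delta> c F =
     (\<Sum>v\<in>\<Union>\<Delta> - F. (-1) ^ card {u \<in> F. ord u < ord v} * c (insert v F))"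

definition cycles :: "('a \<Rightarrow> nat) \<Rightarrow> 'a set set \<Rightarrow> int \<Rightarrow> ('a set \<Rightarrow> 'k::field) set" where
  "cycles ord \<Delta> p = {c \<in> chains \<Delta> p. boundary ord \<Delta> c = (\<lambda>F. 0)}"

definition boundaries :: "('a \<Rightarrow> nat) \<Rightarrow> 'a set set \<Rightarrow> int \<Rightarrow> ('a set \<Rightarrow> 'k::field) set" where
  "boundaries ord \<Delta> p = boundary ord \<Delta> ` chains \<Delta> (p + 1)"

text \<open>
  Homology does not depend on the numbering of the vertices up to isomorphism; rather than fixing
  one, vanishing is required for every numbering (one exists whenever the complex is finite).
\<close>

definition reduced_homology_vanishes :: "'k::field itself \<Rightarrow> 'a set set \<Rightarrow> int \<Rightarrow> bool" where
  "reduced_homology_vanishes K \<Delta> p \<longleftrightarrow>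
     (\<forall>ord. inj_on ord (\<Union>\<Delta>) \<longrightarrow>
        (cycles ord \<Delta> p :: ('a set \<Rightarrow> 'k) set) = boundaries ord \<Delta> p)"

section \<open>Cohen-Macaulay complexes\<close>

text \<open>
  A complex is Cohen-Macaulay over a field \<open>k\<close> if the reduced homology of the link of every
  face, including the empty face, vanishes below the dimension of that link.  The void
  complex, which arises below as the subcomplex generated by no faces at all, counts as
  Cohen-Macaulay.
\<close>

definition cohen_macaulay :: "'k::field itself \<Rightarrow> 'a set set \<Rightarrow> bool" where
  "cohen_macaulay K \<Delta> \<longleftrightarrow>
     (\<forall>F\<in>\<Delta>. \<forall>i < complex_dim (link \<Delta> F). reduced_homology_vanishes K (link \<Delta> F) i)"

definition pure_skeleton :: "'a set set \<Rightarrow> int \<Rightarrow> 'a set set" where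
  "pure_skeleton \<Delta> i = generated_complex {F \<in> \<Delta>. face_dim F = i}"

definition sequentially_cohen_macaulay :: "'k::field itself \<Rightarrow> 'a set set \<Rightarrow> bool" where
  "sequentially_cohen_macaulay K \<Delta> \<longleftrightarrow> (\<forall>i. cohen_macaulay K (pure_skeleton \<Delta> i))"

end

theory Submission
  imports Defs
begin

text \<open>
  Following Woodroofe, the middle vertex of an induced path on three vertices that is not the middle
  part of an induced path on five vertices is a shedding vertex of the independence complex, provided
  there is no induced 4-cycle.  Such a path exists as soon as some induced path on three vertices does
  and there are no induced cycles of length at least six; otherwise the graph is a disjoint union of
  cliques.  Induction over the vertex set yields vertex decomposability.

  A shelling of the deletion of a shedding vertex \<open>v\<close> followed by the join of \<open>v\<close> with a shelling
  of the link is a shelling.  Taking pure skeletons commutes with the deletion and the link of a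
  shedding vertex, and a Mayer-Vietoris argument on chains lifts the vanishing of homology from
  these two to the complex.
\<close>

text \<open>Lengths 4 and at least 6 are excluded for different reasons. A 4-cycle spoils the
  shedding property; a cycle of length at least 6 is what arises when a path extended at both ends
  is closed up through further vertices. A 5-cycle does no harm: the two end vertices of an
  extension are required to be nonadjacent, and in the shedding argument they come from one
  independent set, so closing the path takes at least one more vertex. On the homological side the
  vertices are numbered arbitrarily, so the shedding vertex cannot be assumed to come first; the
  cone operator carries its own sign, and a single homotopy identity for it serves both the
  skeletons of a simplex and the shedding step. Acyclicity of links is measured against a number
  \<open>d\<close> fixed in advance instead of the dimension of each link, so that one bound can be
  followed through deletions and links.\<close>

section \<open>Faces, deletions and links\<close>

lemma finite_simplicial_vertices:
  "simplicial_complex \<Delta> \<Longrightarrow> finite (\<Union>\<Delta>)"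
  by (auto simp: simplicial_complex_def)

lemma simplicial_complex_down:
  "simplicial_complex \<Delta> \<Longrightarrow> F \<in> \<Delta> \<Longrightarrow> G \<subseteq> F \<Longrightarrow> G \<in> \<Delta>"
  by (auto simp: simplicial_complex_def)

lemma simplicial_complex_finite_face:
  "simplicial_complex \<Delta> \<Longrightarrow> F \<in> \<Delta> \<Longrightarrow> finite F"
  by (auto simp: simplicial_complex_def)

lemma simplicial_complex_empty_face:
  "simplicial_complex \<Delta> \<Longrightarrow> {} \<in> \<Delta>"
  by (auto simp: simplicial_complex_def)

lemma link_subset: "simplicial_complex \<Delta> \<Longrightarrow> link \<Delta> F \<subseteq> \<Delta>"
  by (auto simp: link_def intro: simplicial_complex_down)

lemma deletion_subset: "deletion \<Delta> v \<subseteq> \<Delta>"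
  by (auto simp: deletion_def)

lemma simplicial_complex_deletion:
  assumes "simplicial_complex \<Delta>"
  shows "simplicial_complex (deletion \<Delta> v)"
  using assms simplicial_complex_empty_face[OF assms]
  by (auto simp: simplicial_complex_def deletion_def)

lemma simplicial_complex_link:
  assumes "simplicial_complex \<Delta>" "F \<in> \<Delta>"
  shows "simplicial_complex (link \<Delta> F)"
  unfolding simplicial_complex_def
proof (intro conjI ballI)
  show "finite (link \<Delta> F)"
    using finite_subset[OF link_subset[OF assms(1)]] assms(1) by (simp add: simplicial_complex_def)
  show "link \<Delta> F \<noteq> {}"
    using assms by (auto simp: link_def)
  fix G assume G: "G \<in> link \<Delta> F"
  then show "finite G"
    using assms link_subset simplicial_complex_finite_face by blast
  show "Pow G \<subseteq> link \<Delta> F"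
  proof
    fix H assume "H \<in> Pow G"
    then have "H \<inter> F = {}" "H \<union> F \<subseteq> G \<union> F" "G \<union> F \<in> \<Delta>"
      using G by (auto simp: link_def)
    then show "H \<in> link \<Delta> F"
      using simplicial_complex_down[OF assms(1), of "G \<union> F" "H \<union> F"] by (auto simp: link_def)
  qed
qed

section \<open>Boundary and cone operators\<close>

text \<open>The exponent is the position of \<open>v\<close> among the vertices of
  \<open>insert v F\<close> sorted by \<open>ord\<close>, so this is the sign of \<open>F\<close> in
  the boundary of \<open>insert v F\<close>.\<close>

definition incidence :: "('a \<Rightarrow> nat) \<Rightarrow> 'a \<Rightarrow> 'a set \<Rightarrow> 'k::field" where
  "incidence ord v F = (-1) ^ card {u \<in> F. ord u < ord v}"

text \<open>The join of \<open>v\<close> with \<open>c\<close>, with \<open>v\<close> written in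
  front of each face. The sign moves \<open>v\<close> to its sorted place. Coefficients of
  \<open>c\<close> at faces through \<open>v\<close> are dropped.\<close>

definition cone_chain :: "('a \<Rightarrow> nat) \<Rightarrow> 'a \<Rightarrow> ('a set \<Rightarrow> 'k::field) \<Rightarrow> 'a set \<Rightarrow> 'k" where
  "cone_chain ord v c F = (if v \<in> F then incidence ord v (F - {v}) * c (F - {v}) else 0)"

lemma boundary_incidence:
  "boundary ord \<Delta> c F = (\<Sum>v\<in>\<Union>\<Delta> - F. incidence ord v F * c (insert v F))"
  by (simp add: boundary_def incidence_def)

lemma incidence_square [simp]: "incidence ord v F * incidence ord v F = (1::'k::field)"
  by (simp add: incidence_def flip: power_mult_distrib)

lemma incidence_insert:
  assumes "finite F" "w \<notin> F"
  shows "incidence ord u (insert w F) =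
    (if ord w < ord u then - incidence ord u F else (incidence ord u F :: 'k::field))"
proof (cases "ord w < ord u")
  case True
  then have "{x \<in> insert w F. ord x < ord u} = insert w {x \<in> F. ord x < ord u}"
    by auto
  with True assms show ?thesis
    by (simp add: incidence_def)
next
  case False
  then have "{x \<in> insert w F. ord x < ord u} = {x \<in> F. ord x < ord u}"
    by auto
  with False show ?thesis
    by (simp add: incidence_def)
qed

text \<open>Of the two vertices, only the one with the larger number sees the other, and only if the
  other is inserted first. Hence the two orders of insertion differ by exactly one sign.\<close>

lemma incidence_swap:
  assumes "finite F" "u \<notin> F" "w \<notin> F" "ord u \<noteq> ord w"
  shows "incidence ord u F * incidence ord w (insert u F) =
    - (incidence ord w F * incidence ord u (insert w F) :: 'k::field)"
  using assms by (auto simp: incidence_insert)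

text \<open>The complex enters \<open>boundary\<close> only through its vertex set, and vertices
  that no face of the support contains contribute zero. This allows chains of the deletion and of
  the link to be differentiated in the whole complex.\<close>

lemma boundary_subcomplex:
  assumes "finite (\<Union>\<Gamma>)" "\<Lambda> \<subseteq> \<Gamma>" "\<And>F. c F \<noteq> 0 \<Longrightarrow> F \<in> \<Lambda>"
  shows "boundary ord \<Gamma> c = boundary ord \<Lambda> c"
proof
  fix F
  have "c (insert v F) = 0" if "v \<in> (\<Union>\<Gamma> - F) - (\<Union>\<Lambda> - F)" for v
    using assms(3)[of "insert v F"] that by auto
  then show "boundary ord \<Gamma> c F = boundary ord \<Lambda> c F"
    unfolding boundary_def using assms(1,2)
    by (intro sum.mono_neutral_right) auto
qed

lemma boundary_add:
  "boundary ord \<Delta> (\<lambda>F. c F + d F) F = boundary ord \<Delta> c F + boundary ord \<Delta> d F"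
  by (simp add: boundary_def algebra_simps sum.distrib)

lemma boundary_diff:
  "boundary ord \<Delta> (\<lambda>F. c F - d F) F = boundary ord \<Delta> c F - boundary ord \<Delta> d F"
  by (simp add: boundary_def algebra_simps sum_subtractf)

text \<open>The double sum runs over ordered pairs of distinct vertices added to \<open>F\<close>.
  Exchanging the two is a bijection between the pairs increasing in \<open>ord\<close> and the
  decreasing ones, and it reverses the sign.\<close>

lemma boundary_boundary:
  fixes c :: "'a set \<Rightarrow> 'k::field"
  assumes "finite (\<Union>\<Delta>)" "inj_on ord (\<Union>\<Delta>)" "finite F"
  shows "boundary ord \<Delta> (boundary ord \<Delta> c) F = 0"
proof -
  define V where "V = \<Union>\<Delta> - F"
  define g where "g = (\<lambda>(u, w). incidence ord u F * incidence ord w (insert u F) *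
    c (insert w (insert u F)))"
  define L where "L = {(u, w). u \<in> V \<and> w \<in> V \<and> ord u < ord w}"
  define R where "R = {(u, w). u \<in> V \<and> w \<in> V \<and> ord w < ord u}"
  have finV: "finite V"
    using assms(1) by (simp add: V_def)
  have fin: "finite L" "finite R"
    by (rule finite_subset[of _ "V \<times> V"]; use finV in \<open>auto simp: L_def R_def\<close>)+
  have "\<Union>\<Delta> - insert u F = V - {u}" for u
    by (auto simp: V_def)
  then have "boundary ord \<Delta> (boundary ord \<Delta> c) F = (\<Sum>u\<in>V. \<Sum>w\<in>V - {u}. g (u, w))"
    by (simp only: boundary_incidence V_def[symmetric] g_def prod.case sum_distrib_left mult.assoc)
  also have "\<dots> = (\<Sum>p\<in>(SIGMA u:V. V - {u}). g p)"
    using finV by (subst sum.Sigma) auto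
  also have "(SIGMA u:V. V - {u}) = L \<union> R"
  proof -
    have "u = w \<longleftrightarrow> ord u = ord w" if "u \<in> V" "w \<in> V" for u w
      using that inj_on_eq_iff[OF assms(2)] by (simp add: V_def)
    then show ?thesis
      unfolding L_def R_def by (auto dest: linorder_neqE_nat)
  qed
  also have "(\<Sum>p\<in>L \<union> R. g p) = (\<Sum>p\<in>L. g p) + (\<Sum>p\<in>R. g p)"
    using fin by (intro sum.union_disjoint) (auto simp: L_def R_def)
  also have "(\<Sum>p\<in>R. g p) = (\<Sum>p\<in>L. g (prod.swap p))"
    by (rule sum.reindex_bij_witness[of _ prod.swap prod.swap]) (auto simp: L_def R_def)
  also have "\<dots> = (\<Sum>p\<in>L. - g p)"
  proof (intro sum.cong refl)
    fix p assume "p \<in> L"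
    then obtain u w where p: "p = (u, w)" "u \<notin> F" "w \<notin> F" "ord w \<noteq> ord u"
      by (auto simp: L_def V_def)
    show "g (prod.swap p) = - g p"
      using incidence_swap[OF assms(3) p(3,2,4), where ?'k='k]
      by (simp add: p(1) g_def insert_commute)
  qed
  finally show ?thesis
    by (simp add: sum_negf)
qed

text \<open>The cone operator is a contracting homotopy of the chains on all finite sets, whether or
  not these are faces. If \<open>v\<close> is not in \<open>F\<close>, adding \<open>v\<close> is
  the only way to reach the cone. If it is, the terms for the other vertices cancel by the sign rule
  and the term for \<open>v\<close> leaves \<open>c F\<close>.\<close>

lemma boundary_cone_chain:
  fixes c :: "'a set \<Rightarrow> 'k::field"
  assumes "finite (\<Union>\<Delta>)" "inj_on ord (\<Union>\<Delta>)" "v \<in> \<Union>\<Delta>" "finite F"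
  shows "boundary ord \<Delta> (cone_chain ord v c) F + cone_chain ord v (boundary ord \<Delta> c) F = c F"
proof (cases "v \<in> F")
  case False
  have "boundary ord \<Delta> (cone_chain ord v c) F =
      (\<Sum>u\<in>{v}. incidence ord u F * cone_chain ord v c (insert u F))"
    unfolding boundary_incidence using False assms
    by (intro sum.mono_neutral_right) (auto simp: cone_chain_def)
  also have "\<dots> = c F"
    using False by (simp add: cone_chain_def flip: mult.assoc)
  finally show ?thesis
    using False by (simp add: cone_chain_def)
next
  case True
  then obtain G where G: "F = insert v G" "v \<notin> G"
    by (meson mk_disjoint_insert)
  define U where "U = \<Union>\<Delta> - F"
  have finG: "finite G" and U: "finite U" "v \<notin> U" "\<Union>\<Delta> - G = insert v U"
    using G assms by (auto simp: U_def)
  have "boundary ord \<Delta> (cone_chain ord v c) F =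
      (\<Sum>u\<in>U. incidence ord u (insert v G) * (incidence ord v (insert u G) * c (insert u G)))"
    unfolding boundary_incidence U_def[symmetric]
  proof (intro sum.cong refl)
    fix u assume "u \<in> U"
    then have "insert u F - {v} = insert u G"
      using G by (auto simp: U_def)
    then show "incidence ord u F * cone_chain ord v c (insert u F) =
        incidence ord u (insert v G) * (incidence ord v (insert u G) * c (insert u G))"
      using G by (simp add: cone_chain_def)
  qed
  moreover have "cone_chain ord v (boundary ord \<Delta> c) F =
      incidence ord v G * (incidence ord v G * c F +
        (\<Sum>u\<in>U. incidence ord u G * c (insert u G)))"
    using G U by (simp add: cone_chain_def boundary_incidence)
  moreover have "(\<Sum>u\<in>U. incidence ord u (insert v G) * (incidence ord v (insert u G) * c (insert u G)))
      = - (incidence ord v G * (\<Sum>u\<in>U. incidence ord u G * c (insert u G)))"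
    unfolding sum_distrib_left sum_negf[symmetric]
  proof (intro sum.cong refl)
    fix u assume u: "u \<in> U"
    then have *: "u \<notin> G" "ord u \<noteq> ord v"
      using G assms(2,3) by (auto simp: U_def dest: inj_onD)
    show "incidence ord u (insert v G) * (incidence ord v (insert u G) * c (insert u G)) =
        - (incidence ord v G * (incidence ord u G * c (insert u G)))"
      using * finG G(2) by (auto simp: incidence_insert)
  qed
  ultimately show ?thesis
    by (simp add: algebra_simps)
qed

lemma boundary_in_chains:
  fixes c :: "'a set \<Rightarrow> 'k::field"
  assumes \<Delta>: "simplicial_complex \<Delta>" and c: "c \<in> chains \<Delta> (p + 1)"
  shows "boundary ord \<Delta> c \<in> chains \<Delta> p"
proof -
  have "F \<in> \<Delta> \<and> face_dim F = p" if nz: "boundary ord \<Delta> c F \<noteq> 0" for F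
  proof -
    obtain v where v: "v \<in> \<Union>\<Delta> - F" "c (insert v F) \<noteq> 0"
      using nz unfolding boundary_def by (metis (no_types, lifting) mult_zero_right sum.neutral)
    then have "insert v F \<in> \<Delta>" "face_dim (insert v F) = p + 1"
      using c by (auto simp: chains_def)
    moreover from this have "finite F" "F \<in> \<Delta>"
      using simplicial_complex_finite_face[OF \<Delta>] simplicial_complex_down[OF \<Delta>] by blast+
    ultimately show ?thesis
      using v by (simp add: face_dim_def)
  qed
  then show ?thesis
    by (auto simp: chains_def)
qed

text \<open>Chains are functions on all sets, while the sign identities above hold only at finite
  ones. This supplies the remaining values when two chains are compared as functions.\<close>

lemma boundary_infinite_face:
  assumes "simplicial_complex \<Delta>" "c \<in> chains \<Delta> p" "infinite F"
  shows "boundary ord \<Delta> c F = 0"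
  unfolding boundary_def
proof (intro sum.neutral ballI)
  fix v assume "v \<in> \<Union>\<Delta> - F"
  have "insert v F \<notin> \<Delta>"
    using assms(3) simplicial_complex_finite_face[OF assms(1)] finite_insert by metis
  then show "(- 1) ^ card {u \<in> F. ord u < ord v} * c (insert v F) = 0"
    using assms(2) by (auto simp: chains_def)
qed

section \<open>Criteria for the vanishing of reduced homology\<close>

lemma boundaries_subset_cycles:
  assumes \<Delta>: "simplicial_complex \<Delta>" and ord: "inj_on ord (\<Union>\<Delta>)"
  shows "(boundaries ord \<Delta> p :: ('a set \<Rightarrow> 'k::field) set) \<subseteq> cycles ord \<Delta> p"
proof
  fix b :: "'a set \<Rightarrow> 'k" assume "b \<in> boundaries ord \<Delta> p"
  then obtain c where c: "c \<in> chains \<Delta> (p + 1)" and b: "b = boundary ord \<Delta> c"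
    by (auto simp: boundaries_def)
  have b_chain: "b \<in> chains \<Delta> p"
    using boundary_in_chains[OF \<Delta> c] b by simp
  have "boundary ord \<Delta> b F = 0" for F
    using boundary_boundary[OF finite_simplicial_vertices[OF \<Delta>] ord, of F c]
      boundary_infinite_face[OF \<Delta> b_chain, of F ord] b by metis
  with b_chain show "b \<in> cycles ord \<Delta> p"
    by (auto simp: cycles_def)
qed

lemma reduced_homology_vanishesI:
  assumes "simplicial_complex \<Delta>"
    and "\<And>ord (c :: 'a set \<Rightarrow> 'k::field). inj_on ord (\<Union>\<Delta>) \<Longrightarrow> c \<in> chains \<Delta> p \<Longrightarrow>
      boundary ord \<Delta> c = (\<lambda>F. 0) \<Longrightarrow> c \<in> boundaries ord \<Delta> p"
  shows "reduced_homology_vanishes TYPE('k) \<Delta> p"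
  unfolding reduced_homology_vanishes_def
proof (intro allI impI subset_antisym)
  fix ord :: "'a \<Rightarrow> nat" assume ord: "inj_on ord (\<Union>\<Delta>)"
  show "(cycles ord \<Delta> p :: ('a set \<Rightarrow> 'k) set) \<subseteq> boundaries ord \<Delta> p"
    using assms(2)[OF ord] by (auto simp: cycles_def)
  show "(boundaries ord \<Delta> p :: ('a set \<Rightarrow> 'k) set) \<subseteq> cycles ord \<Delta> p"
    by (rule boundaries_subset_cycles[OF assms(1) ord])
qed

lemma reduced_homology_vanishesD:
  assumes "reduced_homology_vanishes TYPE('k::field) \<Delta> p" "inj_on ord (\<Union>\<Delta>)"
    and "(c :: 'a set \<Rightarrow> 'k) \<in> chains \<Delta> p" "\<And>F. boundary ord \<Delta> c F = 0"
  obtains e where "e \<in> chains \<Delta> (p + 1)" "c = boundary ord \<Delta> e"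
proof -
  have "c \<in> cycles ord \<Delta> p"
    using assms(3,4) by (simp add: cycles_def fun_eq_iff)
  then have "c \<in> boundaries ord \<Delta> p"
    using assms(1,2) by (simp add: reduced_homology_vanishes_def)
  then show thesis
    using that by (auto simp: boundaries_def)
qed

text \<open>For a cycle the homotopy identity says that it is the boundary of its cone, and the cone
  only needs the faces of dimension \<open>p\<close> to be joinable with \<open>v\<close>. The
  restriction to one dimension matters because a skeleton of a simplex is a cone only below its top
  dimension.\<close>

lemma reduced_homology_vanishes_cone:
  assumes \<Delta>: "simplicial_complex \<Delta>" and v: "{v} \<in> \<Delta>"
    and cone: "\<And>F. F \<in> \<Delta> \<Longrightarrow> face_dim F = p \<Longrightarrow> insert v F \<in> \<Delta>"
  shows "reduced_homology_vanishes TYPE('k::field) \<Delta> p"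
proof (rule reduced_homology_vanishesI[OF \<Delta>])
  fix ord and c :: "'a set \<Rightarrow> 'k"
  assume ord: "inj_on ord (\<Union>\<Delta>)" and c: "c \<in> chains \<Delta> p"
    and cycle: "boundary ord \<Delta> c = (\<lambda>F. 0)"
  have h: "cone_chain ord v c \<in> chains \<Delta> (p + 1)"
    unfolding chains_def
  proof (intro CollectI allI impI)
    fix F assume "cone_chain ord v c F \<noteq> 0"
    then have v: "v \<in> F" and nz: "c (F - {v}) \<noteq> 0"
      by (auto simp: cone_chain_def split: if_splits)
    have F: "F - {v} \<in> \<Delta>" "face_dim (F - {v}) = p"
      using c nz by (auto simp: chains_def)
    then have "finite F"
      using simplicial_complex_finite_face[OF \<Delta>] by (metis finite_Diff_insert finite_Diff2 finite.emptyI)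
    then have "Suc (card (F - {v})) = card F"
      using v by (rule card_Suc_Diff1)
    then have "face_dim F = p + 1"
      using F(2) unfolding face_dim_def by linarith
    moreover have "F \<in> \<Delta>"
      using cone[OF F] v by (simp add: insert_absorb)
    ultimately show "F \<in> \<Delta> \<and> face_dim F = p + 1"
      by simp
  qed
  have "boundary ord \<Delta> (cone_chain ord v c) F = c F" for F
  proof (cases "finite F")
    case True
    then show ?thesis
      using boundary_cone_chain[OF finite_simplicial_vertices[OF \<Delta>] ord UnionI[OF v singletonI], of F c]
      by (simp add: cycle cone_chain_def cong: if_cong)
  next
    case False
    then have "F \<notin> \<Delta>"
      using simplicial_complex_finite_face[OF \<Delta>] by blast
    then show ?thesis
      using boundary_infinite_face[OF \<Delta> h False, of ord] c by (auto simp: chains_def)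
  qed
  then have "c = boundary ord \<Delta> (cone_chain ord v c)"
    by (simp add: fun_eq_iff)
  with h show "c \<in> boundaries ord \<Delta> p"
    by (auto simp: boundaries_def)
qed


text \<open>
  The part of a cycle supported on faces through \<open>v\<close> is a cone over a cycle of the link.  Filling
  the latter in the link pushes the given cycle into the deletion, where it can be filled as well.
\<close>

lemma reduced_homology_vanishes_shedding:
  assumes \<Delta>: "simplicial_complex \<Delta>" and v: "{v} \<in> \<Delta>"
    and del: "reduced_homology_vanishes TYPE('k::field) (deletion \<Delta> v) p"
    and lnk: "reduced_homology_vanishes TYPE('k) (link \<Delta> {v}) (p - 1)"
  shows "reduced_homology_vanishes TYPE('k) \<Delta> p"
proof (rule reduced_homology_vanishesI[OF \<Delta>])
  fix ord and c :: "'a set \<Rightarrow> 'k"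
  assume ord: "inj_on ord (\<Union>\<Delta>)" and c: "c \<in> chains \<Delta> p"
    and cycle: "boundary ord \<Delta> c = (\<lambda>F. 0)"
  define D where "D = deletion \<Delta> v"
  define L where "L = link \<Delta> {v}"
  define h where "h = (cone_chain ord v :: ('a set \<Rightarrow> 'k) \<Rightarrow> _)"
  note fin = finite_simplicial_vertices[OF \<Delta>]
  have sc: "simplicial_complex D" "simplicial_complex L"
    using simplicial_complex_deletion[OF \<Delta>] simplicial_complex_link[OF \<Delta> v] by (simp_all add: D_def L_def)
  have sub: "D \<subseteq> \<Delta>" "L \<subseteq> \<Delta>"
    using link_subset[OF \<Delta>, of "{v}"] deletion_subset[of \<Delta> v] by (simp_all add: D_def L_def)
  have ordD: "inj_on ord (\<Union>D)" and ordL: "inj_on ord (\<Union>L)"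
    using sub by (auto intro: inj_on_subset[OF ord])
  have homotopy: "boundary ord \<Delta> (h e) F = e F - h (boundary ord \<Delta> e) F" if "finite F" for e F
    using boundary_cone_chain[OF fin ord UnionI[OF v singletonI] that, of e]
    by (simp add: h_def algebra_simps)
  \<comment> \<open>\<open>c0\<close> keeps the faces avoiding \<open>v\<close>, and
    \<open>d\<close> is the chain on the link whose cone is the rest of \<open>c\<close>. The sign
    in \<open>d\<close> cancels the one in \<open>cone_chain\<close>.\<close>
  define c0 where "c0 F = (if v \<in> F then 0 else c F)" for F
  define d where "d F = (if v \<in> F then 0 else incidence ord v F * c (insert v F))" for F
  have c_split: "c F = c0 F + h d F" for F
    by (simp add: c0_def d_def h_def cone_chain_def insert_absorb flip: mult.assoc)
  have c_eq: "c = (\<lambda>F. c0 F + h d F)"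
    using c_split by (rule ext)
  have d_chain: "d \<in> chains L (p - 1)"
    unfolding chains_def
  proof (intro CollectI allI impI)
    fix F assume "d F \<noteq> 0"
    then have F: "v \<notin> F" "c (insert v F) \<noteq> 0"
      by (auto simp: d_def split: if_splits)
    then have "insert v F \<in> \<Delta>" "face_dim (insert v F) = p"
      using c by (auto simp: chains_def)
    then show "F \<in> L \<and> face_dim F = p - 1"
      using F(1) simplicial_complex_finite_face[OF \<Delta>, of "insert v F"]
      by (auto simp: L_def link_def face_dim_def)
  qed
  have bd_L: "boundary ord \<Delta> e = boundary ord L e" if "e \<in> chains L q" for e :: "'a set \<Rightarrow> 'k" and q
    using that by (intro boundary_subcomplex fin sub) (auto simp: chains_def)
  have bd_D: "boundary ord \<Delta> e = boundary ord D e" if "e \<in> chains D q" for e :: "'a set \<Rightarrow> 'k" and q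
    using that by (intro boundary_subcomplex fin sub) (auto simp: chains_def)
  have off_v: "boundary ord \<Delta> e F = 0" if "v \<in> F" "\<And>F. v \<in> F \<Longrightarrow> e F = 0" for e :: "'a set \<Rightarrow> 'k" and F
    using that by (simp add: boundary_def)
  have d_cycle: "boundary ord L d F = 0" for F
  proof -
    have "boundary ord \<Delta> d F = 0" if F: "v \<notin> F" "finite F"
    proof -
      have c0_off: "boundary ord \<Delta> c0 (insert v F) = 0"
        by (rule off_v) (simp_all add: c0_def)
      \<comment> \<open>The cycle condition is evaluated at \<open>insert v F\<close>. There
        \<open>c0\<close> contributes nothing and \<open>d\<close> itself vanishes, so the homotopy
        identity leaves only the cone over the boundary of \<open>d\<close>.\<close>
      have "0 = boundary ord \<Delta> (\<lambda>F. c0 F + h d F) (insert v F)"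
        using cycle by (simp flip: c_eq)
      also have "\<dots> = boundary ord \<Delta> (h d) (insert v F)"
        using c0_off by (simp add: boundary_add)
      also have "\<dots> = - h (boundary ord \<Delta> d) (insert v F)"
        using homotopy[of "insert v F" d] F by (simp add: d_def)
      also have "\<dots> = - (incidence ord v F * boundary ord \<Delta> d F)"
        using F by (simp add: h_def cone_chain_def)
      finally have "incidence ord v F * (incidence ord v F * boundary ord \<Delta> d F) = 0"
        by simp
      then show ?thesis
        by (simp flip: mult.assoc)
    qed
    moreover have "boundary ord \<Delta> d F = 0" if "v \<in> F"
      using that by (intro off_v) (simp_all add: d_def)
    moreover have "boundary ord L d F = 0" if "infinite F"
      using boundary_infinite_face[OF sc(2) d_chain that] .
    ultimately show ?thesis
      unfolding bd_L[OF d_chain] by blast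
  qed
  obtain e where e: "e \<in> chains L (p - 1 + 1)" "d = boundary ord L e"
    using reduced_homology_vanishesD[OF lnk[folded L_def] ordL d_chain d_cycle] .
  have e_off: "v \<notin> F \<and> insert v F \<in> \<Delta> \<and> F \<in> D \<and> face_dim F = p" if "e F \<noteq> 0" for F
    using that e(1) sub(2) by (auto simp: chains_def L_def link_def D_def deletion_def)
  have he_chain: "h e \<in> chains \<Delta> (p + 1)"
    unfolding chains_def
  proof (intro CollectI allI impI)
    fix F assume "h e F \<noteq> 0"
    then have vF: "v \<in> F" and "e (F - {v}) \<noteq> 0"
      by (auto simp: h_def cone_chain_def split: if_splits)
    then have F: "F \<in> \<Delta>" "face_dim (F - {v}) = p"
      using e_off[of "F - {v}"] by (auto simp: insert_absorb)
    then have "Suc (card (F - {v})) = card F"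
      using vF simplicial_complex_finite_face[OF \<Delta>] by (intro card_Suc_Diff1)
    then show "F \<in> \<Delta> \<and> face_dim F = p + 1"
      using F unfolding face_dim_def by (intro conjI) linarith+
  qed
  have bd_he: "boundary ord \<Delta> (h e) F = e F - h d F" for F
  proof (cases "finite F")
    case True
    then show ?thesis
      using homotopy[of F e] e bd_L by metis
  next
    case False
    then have "F \<notin> \<Delta>"
      using simplicial_complex_finite_face[OF \<Delta>] by blast
    moreover have "F - {v} \<notin> L"
      using False simplicial_complex_finite_face[OF sc(2)] by (metis finite_Diff_insert finite_Diff2 finite.emptyI)
    then have "h d F = 0"
      using d_chain by (auto simp: chains_def h_def cone_chain_def)
    moreover have "e F = 0"
      using \<open>F \<notin> \<Delta>\<close> e_off sub(1) by blast
    ultimately show ?thesis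
      using boundary_infinite_face[OF \<Delta> he_chain False, of ord] by simp
  qed
  have bb: "boundary ord \<Delta> (boundary ord \<Delta> (h e)) F = 0" for F
    using boundary_boundary[OF fin ord, of F "h e"]
      boundary_infinite_face[OF \<Delta> boundary_in_chains[OF \<Delta> he_chain], of F ord ord] by blast
  \<comment> \<open>Adding the boundary of the cone over \<open>e\<close> replaces the cone over
    \<open>d\<close> by \<open>e\<close>, so the new cycle \<open>g\<close> avoids \<open>v\<close>
    and can be filled in the deletion.\<close>
  define g where "g F = c0 F + e F" for F
  have g: "g = (\<lambda>F. c F + boundary ord \<Delta> (h e) F)"
    by (simp add: g_def fun_eq_iff c_split bd_he)
  have g_chain: "g \<in> chains D p"
    unfolding chains_def
  proof (intro CollectI allI impI)
    fix F assume "g F \<noteq> 0"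
    then have "c0 F \<noteq> 0 \<or> e F \<noteq> 0"
      by (auto simp: g_def)
    then show "F \<in> D \<and> face_dim F = p"
    proof
      assume "c0 F \<noteq> 0"
      then have "v \<notin> F" "c F \<noteq> 0"
        by (simp_all add: c0_def split: if_splits)
      moreover from this have "F \<in> \<Delta> \<and> face_dim F = p"
        using c by (simp add: chains_def)
      ultimately show ?thesis
        by (simp add: D_def deletion_def)
    qed (use e_off in blast)
  qed
  have "boundary ord D g F = boundary ord \<Delta> g F" for F
    by (simp add: bd_D[OF g_chain])
  then have "boundary ord D g F = 0" for F
    unfolding g by (simp add: boundary_add bb cycle)
  then obtain f where f: "f \<in> chains D (p + 1)" "g = boundary ord D f"
    using reduced_homology_vanishesD[OF del[folded D_def] ordD g_chain] by blast
  have "c F = boundary ord \<Delta> (\<lambda>F. f F - h e F) F" for F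
    unfolding boundary_diff bd_D[OF f(1)] f(2)[symmetric] g by simp
  moreover have "(\<lambda>F. f F - h e F) \<in> chains \<Delta> (p + 1)"
    unfolding chains_def
  proof (intro CollectI allI impI)
    fix F assume "f F - h e F \<noteq> 0"
    then have "f F \<noteq> 0 \<or> h e F \<noteq> 0"
      by auto
    then show "F \<in> \<Delta> \<and> face_dim F = p + 1"
      using f(1) he_chain sub(1) by (auto simp: chains_def)
  qed
  ultimately show "c \<in> boundaries ord \<Delta> p"
    unfolding boundaries_def by (metis (no_types, lifting) ext image_eqI)
qed

section \<open>Cohen-Macaulayness of the pure skeletons\<close>

text \<open>
  For a pure complex of dimension \<open>d\<close>, the link of a face \<open>F\<close> has dimension \<open>d - card F\<close>.
\<close>

definition links_acyclic_below :: "'k::field itself \<Rightarrow> 'a set set \<Rightarrow> int \<Rightarrow> bool" where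
  "links_acyclic_below K \<Delta> d \<longleftrightarrow>
     (\<forall>F\<in>\<Delta>. \<forall>i < d - int (card F). reduced_homology_vanishes K (link \<Delta> F) i)"

text \<open>If \<open>v\<close> is in \<open>F\<close>, the link of \<open>F\<close> is a link
  inside the link of \<open>v\<close>, and both the bound and the face lose one. If
  \<open>insert v F\<close> is a face, deletion and link of \<open>v\<close> commute with the link
  of \<open>F\<close>, and the homology lemma applies in degrees \<open>i\<close> and
  \<open>i - 1\<close>. Otherwise the link of \<open>F\<close> does not involve
  \<open>v\<close>.\<close>

lemma links_acyclic_below_shedding:
  assumes \<Delta>: "simplicial_complex \<Delta>" and v: "{v} \<in> \<Delta>"
    and del: "links_acyclic_below TYPE('k::field) (deletion \<Delta> v) d"
    and lnk: "links_acyclic_below TYPE('k) (link \<Delta> {v}) (d - 1)"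
  shows "links_acyclic_below TYPE('k) \<Delta> d"
  unfolding links_acyclic_below_def
proof (intro ballI allI impI)
  fix F i assume F: "F \<in> \<Delta>" and i: "i < d - int (card F)"
  show "reduced_homology_vanishes TYPE('k) (link \<Delta> F) i"
  proof (cases "v \<in> F")
    case True
    then have "insert v (G \<union> (F - {v})) = G \<union> F" for G
      by blast
    then have "link \<Delta> F = link (link \<Delta> {v}) (F - {v})" "F - {v} \<in> link \<Delta> {v}"
      using F True by (auto simp: link_def insert_absorb)
    moreover have "Suc (card (F - {v})) = card F"
      using True simplicial_complex_finite_face[OF \<Delta> F] by (intro card_Suc_Diff1)
    then have "i < d - 1 - int (card (F - {v}))"
      using i by linarith
    ultimately show ?thesis
      using lnk by (simp add: links_acyclic_below_def)
  next
    case False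
    have del': "reduced_homology_vanishes TYPE('k) (link (deletion \<Delta> v) F) i"
      using del F False i by (simp add: links_acyclic_below_def deletion_def)
    show ?thesis
    proof (cases "insert v F \<in> \<Delta>")
      case True
      have "reduced_homology_vanishes TYPE('k) (link (link \<Delta> {v}) F) (i - 1)"
        using lnk True False i by (simp add: links_acyclic_below_def link_def)
      moreover have "link (link \<Delta> {v}) F = link (link \<Delta> F) {v}"
        using False by (auto simp: link_def)
      moreover have "link (deletion \<Delta> v) F = deletion (link \<Delta> F) v"
        using False by (auto simp: link_def deletion_def)
      ultimately show ?thesis
        using del' True False reduced_homology_vanishes_shedding[OF simplicial_complex_link[OF \<Delta> F], of v i]
        by (simp add: link_def)
    next
      case no: False
      have "link (deletion \<Delta> v) F = link \<Delta> F"
      proof -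
        have "v \<notin> G" if "G \<union> F \<in> \<Delta>" for G
          using no simplicial_complex_down[OF \<Delta> that, of "insert v F"] by auto
        then show ?thesis
          using False by (auto simp: link_def deletion_def)
      qed
      with del' show ?thesis
        by simp
    qed
  qed
qed

section \<open>Pure skeletons\<close>

lemma mem_pure_skeleton_iff:
  "F \<in> pure_skeleton \<Delta> i \<longleftrightarrow> (\<exists>G\<in>\<Delta>. face_dim G = i \<and> F \<subseteq> G)"
  by (auto simp: pure_skeleton_def generated_complex_def)

lemma pure_skeleton_subset: "simplicial_complex \<Delta> \<Longrightarrow> pure_skeleton \<Delta> i \<subseteq> \<Delta>"
  by (auto simp: mem_pure_skeleton_iff intro: simplicial_complex_down)

lemma simplicial_complex_pure_skeleton:
  assumes "simplicial_complex \<Delta>" "pure_skeleton \<Delta> i \<noteq> {}"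
  shows "simplicial_complex (pure_skeleton \<Delta> i)"
  unfolding simplicial_complex_def
proof (intro conjI ballI)
  show "finite (pure_skeleton \<Delta> i)"
    using finite_subset[OF pure_skeleton_subset[OF assms(1)]] assms(1) by (simp add: simplicial_complex_def)
  fix F assume F: "F \<in> pure_skeleton \<Delta> i"
  then show "finite F"
    using pure_skeleton_subset[OF assms(1)] simplicial_complex_finite_face[OF assms(1)] by blast
  show "Pow F \<subseteq> pure_skeleton \<Delta> i"
    using F by (fastforce simp: mem_pure_skeleton_iff)
qed fact

text \<open>An upper bound on the dimension of the link suffices, since vanishing is asked only
  below that dimension. The bound holds because a face of the link together with \<open>F\<close>
  lies in a face with \<open>d + 1\<close> elements.\<close>

lemma links_acyclic_below_pure_skeleton_cohen_macaulay:
  assumes \<Delta>: "simplicial_complex \<Delta>" and acyclic: "links_acyclic_below TYPE('k::field) (pure_skeleton \<Delta> d) d"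
  shows "cohen_macaulay TYPE('k) (pure_skeleton \<Delta> d)"
  unfolding cohen_macaulay_def
proof (intro ballI allI impI)
  let ?S = "pure_skeleton \<Delta> d"
  fix F i assume F: "F \<in> ?S" and i: "i < complex_dim (link ?S F)"
  have S: "simplicial_complex ?S"
    using simplicial_complex_pure_skeleton[OF \<Delta>] F by blast
  have L: "simplicial_complex (link ?S F)"
    by (rule simplicial_complex_link[OF S F])
  have "complex_dim (link ?S F) \<le> d - int (card F)"
    unfolding complex_dim_def
  proof (rule Max.boundedI)
    show "finite (face_dim ` link ?S F)" "face_dim ` link ?S F \<noteq> {}"
      using L by (auto simp: simplicial_complex_def)
    fix x assume "x \<in> face_dim ` link ?S F"
    then obtain G where G: "x = face_dim G" "G \<inter> F = {}" "G \<union> F \<in> ?S"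
      by (auto simp: link_def)
    then obtain H where H: "H \<in> \<Delta>" "face_dim H = d" "G \<union> F \<subseteq> H"
      by (auto simp: mem_pure_skeleton_iff)
    have finH: "finite H"
      using simplicial_complex_finite_face[OF \<Delta> H(1)] .
    then have "finite G" "finite F"
      using H(3) by (auto intro: finite_subset)
    then have "card G + card F = card (G \<union> F)"
      using G(2) by (simp add: card_Un_disjoint)
    also have "\<dots> \<le> card H"
      using H(3) finH by (intro card_mono)
    finally show "x \<le> d - int (card F)"
      using G(1) H(2) by (simp add: face_dim_def)
  qed
  then show "reduced_homology_vanishes TYPE('k) (link ?S F) i"
    using acyclic F i by (simp add: links_acyclic_below_def)
qed

text \<open>Any vertex \<open>v\<close> of a \<open>d\<close>-face containing \<open>F\<close>, but
  outside \<open>F\<close>, is an apex for all faces of the link below the top dimension: adding it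
  keeps the size within \<open>d + 1\<close>.\<close>

lemma links_acyclic_below_simplex_skeleton:
  assumes "finite S"
  shows "links_acyclic_below TYPE('k::field) (pure_skeleton (Pow S) d) d"
  unfolding links_acyclic_below_def
proof (intro ballI allI impI)
  let ?P = "pure_skeleton (Pow S) d"
  fix F i assume F: "F \<in> ?P" and i: "i < d - int (card F)"
  have P: "simplicial_complex ?P"
    using F assms by (intro simplicial_complex_pure_skeleton) (auto simp: simplicial_complex_def finite_subset)
  obtain H where H: "H \<subseteq> S" "int (card H) = d + 1" "F \<subseteq> H"
    using F by (auto simp: mem_pure_skeleton_iff face_dim_def)
  \<comment> \<open>The face \<open>H\<close> shows that \<open>S\<close> has at least
    \<open>d + 1\<close> elements, so a subset with at most that many can be enlarged to exactly
    that many.\<close>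
  have mem: "G \<in> ?P \<longleftrightarrow> G \<subseteq> S \<and> int (card G) \<le> d + 1" for G
  proof
    assume "G \<in> ?P"
    then obtain K where "K \<subseteq> S" "face_dim K = d" "G \<subseteq> K"
      by (auto simp: mem_pure_skeleton_iff)
    then show "G \<subseteq> S \<and> int (card G) \<le> d + 1"
      using card_mono[of K G] finite_subset[OF _ assms] by (auto simp: face_dim_def)
  next
    assume G: "G \<subseteq> S \<and> int (card G) \<le> d + 1"
    then obtain K where "G \<subseteq> K" "K \<subseteq> S" "card K = card H"
      using obtain_subset_with_card_n exists_subset_between[of G "card H" S] H assms card_mono[OF assms H(1)] by auto
    moreover from this have "face_dim K = d"
      using H(2) by (simp add: face_dim_def)
    ultimately show "G \<in> ?P"
      by (auto simp: mem_pure_skeleton_iff)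
  qed
  have L: "simplicial_complex (link ?P F)"
    by (rule simplicial_complex_link[OF P F])
  show "reduced_homology_vanishes TYPE('k) (link ?P F) i"
  \<comment> \<open>Below dimension -1 the zero chain is the only one. From -1 on, the bound on
    \<open>i\<close> makes \<open>F\<close> a proper subset of \<open>H\<close>, which provides the
    apex.\<close>
  proof (cases "i < -1")
    case True
    have "c = (\<lambda>F. 0)" if "c \<in> chains (link ?P F) i" for c :: "'a set \<Rightarrow> 'k"
      using that True by (force simp: chains_def face_dim_def)
    moreover have "(\<lambda>F. 0) \<in> (boundaries ord (link ?P F) i :: ('a set \<Rightarrow> 'k) set)" for ord
      by (auto simp: boundaries_def boundary_def chains_def fun_eq_iff intro!: image_eqI[of _ _ "\<lambda>F. 0"])
    ultimately show ?thesis
      by (intro reduced_homology_vanishesI L) blast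
  next
    case False
    then have "card F < card H"
      using i H(2) by linarith
    then obtain v where v: "v \<in> H" "v \<notin> F"
      using H(3) by (metis less_irrefl subset_antisym subsetI)
    have cone: "insert v G \<in> link ?P F" if G: "G \<in> link ?P F" "int (card G) \<le> d - int (card F)" for G
    proof -
      have "card (insert v G \<union> F) \<le> card (insert v G) + card F"
        by (rule card_Un_le)
      also have "\<dots> \<le> Suc (card G) + card F"
        by (simp add: card_insert_le_m1 card_insert_if)
      finally have "int (card (insert v G \<union> F)) \<le> d + 1"
        using G(2) by linarith
      then show ?thesis
        using G(1) v H(1) by (auto simp: link_def mem)
    qed
    show ?thesis
    proof (rule reduced_homology_vanishes_cone[OF L, of v])
      have "{} \<in> link ?P F"
        using simplicial_complex_empty_face[OF L] .
      then show "{v} \<in> link ?P F"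
        using cone[of "{}"] False i by simp
      fix G assume "G \<in> link ?P F" "face_dim G = i"
      then show "insert v G \<in> link ?P F"
        using cone[of G] i by (simp add: face_dim_def)
    qed
  qed
qed

lemma link_pure_skeleton:
  assumes "simplicial_complex \<Delta>"
  shows "link (pure_skeleton \<Delta> d) {v} = pure_skeleton (link \<Delta> {v}) (d - 1)"
proof (intro subset_antisym subsetI)
  fix F assume "F \<in> link (pure_skeleton \<Delta> d) {v}"
  then obtain H where H: "v \<notin> F" "H \<in> \<Delta>" "face_dim H = d" "insert v F \<subseteq> H"
    by (auto simp: link_def mem_pure_skeleton_iff)
  then have "Suc (card (H - {v})) = card H"
    using simplicial_complex_finite_face[OF assms] by (intro card_Suc_Diff1) auto
  then have "face_dim (H - {v}) = d - 1"
    using H(3) unfolding face_dim_def by linarith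
  moreover have "H - {v} \<in> link \<Delta> {v}"
    using H by (auto simp: link_def insert_absorb)
  moreover have "F \<subseteq> H - {v}"
    using H by auto
  ultimately show "F \<in> pure_skeleton (link \<Delta> {v}) (d - 1)"
    unfolding mem_pure_skeleton_iff by blast
next
  fix F assume "F \<in> pure_skeleton (link \<Delta> {v}) (d - 1)"
  then obtain H where H: "v \<notin> H" "insert v H \<in> \<Delta>" "face_dim H = d - 1" "F \<subseteq> H"
    by (auto simp: link_def mem_pure_skeleton_iff)
  moreover have "face_dim (insert v H) = d"
    using H simplicial_complex_finite_face[OF assms H(2)] by (auto simp: face_dim_def)
  moreover have "insert v F \<subseteq> insert v H"
    using H by blast
  ultimately show "F \<in> link (pure_skeleton \<Delta> d) {v}"
    by (auto simp: link_def mem_pure_skeleton_iff)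
qed

text \<open>
  The shedding condition allows one to replace the vertex \<open>v\<close> of a face by another one, so that
  deleting \<open>v\<close> commutes with taking pure skeletons.
\<close>

lemma deletion_pure_skeleton:
  assumes \<Delta>: "simplicial_complex \<Delta>"
    and shed: "link \<Delta> {v} \<inter> facets (deletion \<Delta> v) = {}"
  shows "deletion (pure_skeleton \<Delta> d) v = pure_skeleton (deletion \<Delta> v) d"
proof (intro subset_antisym subsetI)
  fix F assume "F \<in> deletion (pure_skeleton \<Delta> d) v"
  then obtain H where H: "v \<notin> F" "H \<in> \<Delta>" "face_dim H = d" "F \<subseteq> H"
    by (auto simp: deletion_def mem_pure_skeleton_iff)
  show "F \<in> pure_skeleton (deletion \<Delta> v) d"
  proof (cases "v \<in> H")
    case False
    with H show ?thesis
      by (auto simp: deletion_def mem_pure_skeleton_iff)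
  next
    case True
    define K where "K = H - {v}"
    have finH: "finite H"
      using simplicial_complex_finite_face[OF \<Delta> H(2)] .
    have K: "K \<in> link \<Delta> {v}" "K \<in> deletion \<Delta> v"
      using True H(2) simplicial_complex_down[OF \<Delta> H(2), of K]
      by (auto simp: link_def deletion_def K_def insert_absorb)
    then obtain M where M: "M \<in> deletion \<Delta> v" "K \<subseteq> M" "K \<noteq> M"
      using shed by (auto simp: facets_def)
    then obtain w where w: "w \<in> M" "w \<notin> K"
      by blast
    have "insert w K \<in> deletion \<Delta> v"
      using M w simplicial_complex_down[OF \<Delta>, of M "insert w K"] by (auto simp: deletion_def)
    moreover have "card (insert w K) = card H"
      using w finH True card_Suc_Diff1[OF finH True] by (simp add: K_def)
    moreover have "F \<subseteq> insert w K"
      using H by (auto simp: K_def)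
    ultimately show ?thesis
      using H(3) by (auto simp: mem_pure_skeleton_iff face_dim_def)
  qed
next
  fix F assume "F \<in> pure_skeleton (deletion \<Delta> v) d"
  then show "F \<in> deletion (pure_skeleton \<Delta> d) v"
    by (auto simp: deletion_def mem_pure_skeleton_iff)
qed

lemma vertex_decomposable_simplicial_complex:
  "vertex_decomposable \<Delta> \<Longrightarrow> simplicial_complex \<Delta>"
  by (induction rule: vertex_decomposable.induct) (auto simp: simplicial_complex_def finite_subset)

text \<open>The dimension \<open>d\<close> has to vary in the induction because the link of
  \<open>v\<close> is used at \<open>d - 1\<close>.\<close>

lemma vertex_decomposable_links_acyclic:
  assumes "vertex_decomposable \<Delta>"
  shows "links_acyclic_below TYPE('k::field) (pure_skeleton \<Delta> d) d"
  using assms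
proof (induction arbitrary: d rule: vertex_decomposable.induct)
  case (simplex S)
  then show ?case
    by (rule links_acyclic_below_simplex_skeleton)
next
  case (shedding \<Delta> v)
  let ?S = "pure_skeleton \<Delta> d"
  have del: "links_acyclic_below TYPE('k) (deletion ?S v) d"
    using shedding.IH(1) deletion_pure_skeleton[OF shedding.hyps(1) shedding.hyps(5)] by simp
  have lnk: "links_acyclic_below TYPE('k) (link ?S {v}) (d - 1)"
    using shedding.IH(2) link_pure_skeleton[OF shedding.hyps(1)] by simp
  show ?case
  proof (cases "{v} \<in> ?S")
    case True
    then have "simplicial_complex ?S"
      using simplicial_complex_pure_skeleton[OF shedding.hyps(1)] by blast
    then show ?thesis
      using True del lnk by (rule links_acyclic_below_shedding)
  next
    case False
    \<comment> \<open>Here \<open>v\<close> lies in no \<open>d\<close>-face, so the skeleton is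
      already that of the deletion.\<close>
    then have "deletion ?S v = ?S"
      by (fastforce simp: deletion_def mem_pure_skeleton_iff)
    with del show ?thesis
      by simp
  qed
qed

lemma vertex_decomposable_sequentially_cohen_macaulay:
  assumes "vertex_decomposable \<Delta>"
  shows "sequentially_cohen_macaulay TYPE('k::field) \<Delta>"
  unfolding sequentially_cohen_macaulay_def
  using links_acyclic_below_pure_skeleton_cohen_macaulay[OF vertex_decomposable_simplicial_complex[OF assms]
      vertex_decomposable_links_acyclic[OF assms]] by blast

section \<open>Shellability\<close>

text \<open>The classical condition on pairs of facets that characterises shellings. It speaks only
  about the listed sets and not about generated complexes, so it passes easily to concatenations and
  to joins with a vertex.\<close>

definition exchange_order :: "'a set list \<Rightarrow> bool" where
  "exchange_order Fs \<longleftrightarrow> (\<forall>i j. i < j \<and> j < length Fs \<longrightarrow>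
     (\<exists>k<j. \<exists>w\<in>Fs ! j. Fs ! i \<inter> Fs ! j \<subseteq> Fs ! k \<inter> Fs ! j \<and> Fs ! k \<inter> Fs ! j = Fs ! j - {w}))"

text \<open>A facet of the intersection with the earlier part lies in a single earlier set. The
  exchange property encloses it in a set of codimension one, which it must equal by
  maximality.\<close>

lemma shelling_if_exchange_order:
  assumes "distinct Fs" "set Fs = facets \<Delta>" "exchange_order Fs" "\<And>F. F \<in> facets \<Delta> \<Longrightarrow> finite F"
  shows "shelling \<Delta> Fs"
  unfolding shelling_def pure_of_dim_def
proof (intro conjI allI impI ballI)
  fix j A assume j: "0 < j \<and> j < length Fs"
    and A: "A \<in> facets (generated_complex {Fs ! i |i. i < j} \<inter> Pow (Fs ! j))"
  then obtain i where i: "i < j" "A \<subseteq> Fs ! i \<inter> Fs ! j"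
    by (auto simp: facets_def generated_complex_def)
  then obtain k w where k: "k < j" "w \<in> Fs ! j" "A \<subseteq> Fs ! k \<inter> Fs ! j" "Fs ! k \<inter> Fs ! j = Fs ! j - {w}"
    using assms(3) j unfolding exchange_order_def by (meson order_trans)
  have "Fs ! k \<inter> Fs ! j \<in> generated_complex {Fs ! i |i. i < j} \<inter> Pow (Fs ! j)"
    using k(1) by (auto simp: generated_complex_def)
  then have "A = Fs ! j - {w}"
    using A k(3,4) by (simp add: facets_def)
  moreover have "finite (Fs ! j)"
    using assms(2,4) j nth_mem by blast
  then have "Suc (card (Fs ! j - {w})) = card (Fs ! j)"
    using k(2) by (intro card_Suc_Diff1)
  ultimately have "Suc (card A) = card (Fs ! j)"
    by metis
  then show "face_dim A = face_dim (Fs ! j) - 1"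
    unfolding face_dim_def by linarith
qed (use assms in auto)

lemma obtain_facet:
  assumes "simplicial_complex \<Delta>" "F \<in> \<Delta>"
  obtains G where "G \<in> facets \<Delta>" "F \<subseteq> G"
proof -
  have "finite {G \<in> \<Delta>. F \<subseteq> G}" "{G \<in> \<Delta>. F \<subseteq> G} \<noteq> {}"
    using assms by (auto simp: simplicial_complex_def)
  then obtain G where "G \<in> {G \<in> \<Delta>. F \<subseteq> G}" "\<forall>H\<in>{G \<in> \<Delta>. F \<subseteq> G}. G \<subseteq> H \<longrightarrow> G = H"
    using finite_has_maximal[of "{G \<in> \<Delta>. F \<subseteq> G}"] by blast
  then show thesis
    by (intro that[of G]) (auto simp: facets_def)
qed

text \<open>A facet of the deletion can lose maximality in the whole complex only by gaining
  \<open>v\<close>. It would then be a face of the link, which the shedding condition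
  excludes.\<close>

lemma facets_shedding:
  assumes \<Delta>: "simplicial_complex \<Delta>"
    and shed: "link \<Delta> {v} \<inter> facets (deletion \<Delta> v) = {}"
  shows "facets \<Delta> = facets (deletion \<Delta> v) \<union> insert v ` facets (link \<Delta> {v})"
proof (intro subset_antisym subsetI)
  fix F assume F: "F \<in> facets \<Delta>"
  show "F \<in> facets (deletion \<Delta> v) \<union> insert v ` facets (link \<Delta> {v})"
  proof (cases "v \<in> F")
    case False
    with F show ?thesis
      by (auto simp: facets_def deletion_def)
  next
    case True
    then have eq: "F = insert v (F - {v})"
      by blast
    have "F - {v} = G" if "G \<in> link \<Delta> {v}" "F - {v} \<subseteq> G" for G
    proof -
      have "insert v G \<in> \<Delta>" "F \<subseteq> insert v G" "v \<notin> G"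
        using that by (auto simp: link_def)
      then show ?thesis
        using F by (auto simp: facets_def)
    qed
    moreover have "F - {v} \<in> link \<Delta> {v}"
      using F True by (auto simp: link_def facets_def insert_absorb)
    ultimately have "F - {v} \<in> facets (link \<Delta> {v})"
      by (auto simp: facets_def)
    with eq show ?thesis
      by blast
  qed
next
  fix F assume "F \<in> facets (deletion \<Delta> v) \<union> insert v ` facets (link \<Delta> {v})"
  then show "F \<in> facets \<Delta>"
  proof
    assume F: "F \<in> facets (deletion \<Delta> v)"
    have "F = G" if G: "G \<in> \<Delta>" "F \<subseteq> G" for G
    proof (cases "v \<in> G")
      case False
      with F G show ?thesis
        by (auto simp: facets_def deletion_def)
    next
      case True
      have "v \<notin> F"
        using F by (auto simp: facets_def deletion_def)
      moreover have "insert v F \<in> \<Delta>"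
        using simplicial_complex_down[OF \<Delta> G(1)] G(2) True by blast
      ultimately show ?thesis
        using shed F by (auto simp: link_def)
    qed
    then show ?thesis
      using F by (auto simp: facets_def deletion_def)
  next
    assume "F \<in> insert v ` facets (link \<Delta> {v})"
    then obtain K where K: "F = insert v K" "K \<in> facets (link \<Delta> {v})"
      by blast
    have "F = G" if G: "G \<in> \<Delta>" "F \<subseteq> G" for G
    proof -
      have "v \<in> G" "v \<notin> K" "K \<subseteq> G - {v}"
        using G K by (auto simp: facets_def link_def)
      moreover from this have "G - {v} \<in> link \<Delta> {v}"
        using G(1) by (auto simp: link_def insert_absorb)
      ultimately have "K = G - {v}"
        using K(2) by (auto simp: facets_def)
      then show ?thesis
        using K(1) \<open>v \<in> G\<close> by blast
    qed
    then show ?thesis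
      using K by (auto simp: facets_def link_def)
  qed
qed

text \<open>Two joins inherit the exchange from \<open>Gs\<close>. Against an earlier set without
  \<open>v\<close>, the vertex to drop is \<open>v\<close>: some set in \<open>Fs\<close> contains
  the base of the join, so it meets the join in exactly that base, which in turn contains every
  intersection with a set avoiding \<open>v\<close>.\<close>

lemma exchange_order_append_join:
  assumes Fs: "exchange_order Fs" and Gs: "exchange_order Gs"
    and v: "\<And>F. F \<in> set Fs \<Longrightarrow> v \<notin> F" "\<And>G. G \<in> set Gs \<Longrightarrow> v \<notin> G"
    and sub: "\<And>G. G \<in> set Gs \<Longrightarrow> \<exists>F\<in>set Fs. G \<subseteq> F"
  shows "exchange_order (Fs @ map (insert v) Gs)"
  unfolding exchange_order_def
proof (intro allI impI)
  let ?Hs = "Fs @ map (insert v) Gs" and ?n = "length Fs"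
  fix i j assume ij: "i < j \<and> j < length ?Hs"
  show "\<exists>k<j. \<exists>w\<in>?Hs ! j. ?Hs ! i \<inter> ?Hs ! j \<subseteq> ?Hs ! k \<inter> ?Hs ! j \<and> ?Hs ! k \<inter> ?Hs ! j = ?Hs ! j - {w}"
  proof (cases "j < ?n")
    case True
    then obtain k w where "k < j" "w \<in> Fs ! j" "Fs ! i \<inter> Fs ! j \<subseteq> Fs ! k \<inter> Fs ! j"
      "Fs ! k \<inter> Fs ! j = Fs ! j - {w}"
      using Fs ij unfolding exchange_order_def by meson
    with True ij show ?thesis
      by (intro exI[of _ k] conjI bexI[of _ w]) (auto simp: nth_append)
  next
    case False
    define l where "l = j - ?n"
    have l: "j = ?n + l" "l < length Gs"
      using False ij by (auto simp: l_def)
    then have j: "?Hs ! j = insert v (Gs ! l)"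
      by (simp add: nth_append)
    show ?thesis
    proof (cases "i < ?n")
      case True
      then have i: "?Hs ! i = Fs ! i" "v \<notin> Fs ! i"
        using v(1) by (auto simp: nth_append)
      obtain k where k: "k < ?n" "Gs ! l \<subseteq> Fs ! k"
        using sub[of "Gs ! l"] l(2) by (metis in_set_conv_nth)
      then have "?Hs ! k \<inter> ?Hs ! j = ?Hs ! j - {v}"
        using v j l(2) by (auto simp: nth_append)
      then show ?thesis
        using i j k l(1) by (intro exI[of _ k] conjI bexI[of _ v]) auto
    next
      case False
      define m where "m = i - ?n"
      have m: "i = ?n + m" "m < l"
        using False ij l by (auto simp: m_def)
      then have i: "?Hs ! i = insert v (Gs ! m)"
        using l by (simp add: nth_append)
      obtain k w where k: "k < l" "w \<in> Gs ! l" "Gs ! m \<inter> Gs ! l \<subseteq> Gs ! k \<inter> Gs ! l"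
        "Gs ! k \<inter> Gs ! l = Gs ! l - {w}"
        using Gs m l unfolding exchange_order_def by meson
      have "?Hs ! (?n + k) = insert v (Gs ! k)"
        using k(1) l by (simp add: nth_append)
      moreover have "w \<noteq> v"
        using k(2) v(2) l(2) by auto
      ultimately show ?thesis
        using i j k l(1) by (intro exI[of _ "?n + k"] conjI bexI[of _ w]) auto
    qed
  qed
qed

lemma vertex_decomposable_exchange_order:
  assumes "vertex_decomposable \<Delta>"
  shows "\<exists>Fs. distinct Fs \<and> set Fs = facets \<Delta> \<and> exchange_order Fs"
  using assms
proof (induction rule: vertex_decomposable.induct)
  case (simplex S)
  have "facets (Pow S) = {S}"
    by (auto simp: facets_def)
  then show ?case
    by (intro exI[of _ "[S]"]) (simp add: exchange_order_def)
next
  case (shedding \<Delta> v)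
  then obtain Fs Gs where Fs: "distinct Fs" "set Fs = facets (deletion \<Delta> v)" "exchange_order Fs"
    and Gs: "distinct Gs" "set Gs = facets (link \<Delta> {v})" "exchange_order Gs"
    by blast
  have vFs: "v \<notin> F" if "F \<in> set Fs" for F
    using that Fs(2) by (auto simp: facets_def deletion_def)
  have vGs: "v \<notin> G" if "G \<in> set Gs" for G
    using that Gs(2) by (auto simp: facets_def link_def)
  have "\<exists>F\<in>set Fs. G \<subseteq> F" if "G \<in> set Gs" for G
  proof -
    have "G \<in> deletion \<Delta> v"
      using that Gs(2) vGs[OF that] link_subset[OF shedding.hyps(1)] by (auto simp: facets_def deletion_def)
    then show ?thesis
      using obtain_facet[OF simplicial_complex_deletion[OF shedding.hyps(1)]] Fs(2) by metis
  qed
  then have "exchange_order (Fs @ map (insert v) Gs)"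
    using exchange_order_append_join[OF Fs(3) Gs(3) vFs vGs] by blast
  moreover have "inj_on (insert v) (set Gs)"
    using vGs by (intro inj_onI) (metis insert_ident)
  then have "distinct (Fs @ map (insert v) Gs)"
    using Fs(1) Gs(1) vFs by (auto simp: distinct_map)
  moreover have "set (Fs @ map (insert v) Gs) = facets \<Delta>"
    using Fs(2) Gs(2) facets_shedding[OF shedding.hyps(1,5)] by simp
  ultimately show ?case
    by blast
qed

lemma vertex_decomposable_shellable:
  assumes "vertex_decomposable \<Delta>"
  shows "shellable \<Delta>"
proof -
  have "finite F" if "F \<in> facets \<Delta>" for F
    using that simplicial_complex_finite_face[OF vertex_decomposable_simplicial_complex[OF assms]]
    by (auto simp: facets_def)
  then show ?thesis
    using vertex_decomposable_exchange_order[OF assms] shelling_if_exchange_order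
    unfolding shellable_def by blast
qed

section \<open>Induced cycles and paths\<close>

text \<open>Translates the list form of an induced cycle into the isomorphism with
  \<open>cycle_graph\<close>; the isomorphism sends a vertex to its index in the list.\<close>

lemma chordless_cycleI:
  assumes G: "pair_graph G" and n: "3 \<le> length xs"
    and xs: "distinct xs" "set xs \<subseteq> pverts G"
    and adj: "\<And>i j. i < j \<Longrightarrow> j < length xs \<Longrightarrow>
      (xs ! i, xs ! j) \<in> parcs G \<longleftrightarrow> j = Suc i \<or> i = 0 \<and> Suc j = length xs"
  shows "chordless_cycle G (set xs) (length xs)"
proof -
  interpret pair_graph G by fact
  define n where "n = length xs"
  define W where "W = set xs"
  define idx where "idx = the_inv_into {..<n} ((!) xs)"
  define \<phi> where "\<phi> = \<lparr> iso_verts = idx, iso_arcs = map_prod idx idx,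
    iso_head = snd, iso_tail = fst \<rparr>"
  have sym: "(u, v) \<in> parcs G \<longleftrightarrow> (v, u) \<in> parcs G" for u v
    using pair_sym_arcs by (auto simp: symmetric_def sym_def)
  \<comment> \<open>Symmetry and looplessness extend the condition from \<open>i < j\<close> to all
    pairs. The wrap-around of the successor modulo \<open>n\<close> becomes the edge between the
    first and the last entry.\<close>
  have adj': "(xs ! i, xs ! j) \<in> parcs G \<longleftrightarrow> j = Suc i mod n \<or> i = Suc j mod n"
    if ij: "i < n" "j < n" for i j
  proof -
    have mod: "Suc k mod n = (if Suc k = n then 0 else Suc k)" if "k < n" for k
      using that by auto
    consider "i < j" | "j < i" | "i = j"
      by linarith
    then show ?thesis
    proof cases
      case 1
      then show ?thesis
        using adj[of i j] ij n by (auto simp: mod simp flip: n_def)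
    next
      case 2
      then show ?thesis
        using adj[of j i] ij n sym[of "xs ! i"] by (auto simp: mod simp flip: n_def)
    next
      case 3
      then show ?thesis
        using pair_no_loops[of "(xs ! i, xs ! i)"] ij n by (auto simp: mod simp flip: n_def)
    qed
  qed
  have inj: "inj_on ((!) xs) {..<n}"
    using xs(1) by (simp add: n_def inj_on_nth)
  have W: "W = (!) xs ` {..<n}"
    by (auto simp: W_def n_def in_set_conv_nth)
  have idx [simp]: "idx (xs ! i) = i" if "i < n" for i
    using that inj by (simp add: idx_def the_inv_into_f_f)
  have bij: "bij_betw idx W {..<n}"
    unfolding idx_def using inj W by (intro bij_betw_the_inv_into) (simp add: bij_betw_def)
  have arcs: "arcs (with_proj G \<restriction> W) = {(u, v) \<in> parcs G. u \<in> W \<and> v \<in> W}"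
    by auto
  have "map_prod idx idx ` arcs (with_proj G \<restriction> W) = parcs (cycle_graph n)"
  proof (intro subset_antisym subsetI)
    fix e assume "e \<in> map_prod idx idx ` arcs (with_proj G \<restriction> W)"
    then obtain u v where uv: "(u, v) \<in> parcs G" "u \<in> W" "v \<in> W" "e = (idx u, idx v)"
      unfolding arcs by auto
    then obtain i j where "i < n" "j < n" "u = xs ! i" "v = xs ! j"
      unfolding W by auto
    then show "e \<in> parcs (cycle_graph n)"
      using uv adj' by (simp add: cycle_graph_def)
  next
    fix e assume "e \<in> parcs (cycle_graph n)"
    then obtain i j where ij: "e = (i, j)" "i < n" "j < n" "j = Suc i mod n \<or> i = Suc j mod n"
      by (auto simp: cycle_graph_def)
    then have "(xs ! i, xs ! j) \<in> arcs (with_proj G \<restriction> W)"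
      unfolding arcs using adj' W by auto
    then show "e \<in> map_prod idx idx ` arcs (with_proj G \<restriction> W)"
      using ij by (intro image_eqI[of _ _ "(xs ! i, xs ! j)"]) auto
  qed
  then have "with_proj (cycle_graph n) = app_iso \<phi> (with_proj G \<restriction> W)"
    using bij by (simp add: app_iso_def \<phi>_def with_proj_def bij_betw_imp_surj_on cycle_graph_def)
  moreover have "pre_digraph.digraph_isomorphism (with_proj G \<restriction> W) \<phi>"
    unfolding pre_digraph.digraph_isomorphism_def
  proof (intro conjI)
    show "wf_digraph (with_proj G \<restriction> W)"
      by (rule wellformed_induce_subgraph)
    show "inj_on (iso_verts \<phi>) (verts (with_proj G \<restriction> W))"
      using bij by (simp add: \<phi>_def bij_betw_def)
    have "inj_on idx W"
      using bij by (simp add: bij_betw_def)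
    then have "inj_on (map_prod idx idx) (W \<times> W)"
      by (rule map_prod_inj_on) (use \<open>inj_on idx W\<close> in assumption)
    then show "inj_on (iso_arcs \<phi>) (arcs (with_proj G \<restriction> W))"
      unfolding arcs by (simp add: \<phi>_def) (erule inj_on_subset, auto)
  qed (simp add: \<phi>_def)
  ultimately have "digraph_iso (with_proj G \<restriction> W) (with_proj (cycle_graph n))"
    unfolding digraph_iso_def by blast
  then show ?thesis
    using n xs by (simp add: chordless_cycle_def W_def n_def)
qed

section \<open>Induced paths for an abstract adjacency relation\<close>

text \<open>The relation lives on the whole type, so passing to an induced subgraph only means
  shrinking a vertex set \<open>W\<close>.\<close>

locale simple_adjacency =
  fixes E :: "'a \<Rightarrow> 'a \<Rightarrow> bool"
  assumes E_sym: "E u v \<Longrightarrow> E v u"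
    and E_irrefl: "\<not> E u u"
begin

definition induced_cycle :: "'a list \<Rightarrow> bool" where
  "induced_cycle xs \<longleftrightarrow> 3 \<le> length xs \<and> distinct xs \<and>
     (\<forall>i j. i < j \<and> j < length xs \<longrightarrow>
        (E (xs ! i) (xs ! j) \<longleftrightarrow> j = Suc i \<or> i = 0 \<and> Suc j = length xs))"

definition induced_P3 :: "'a set \<Rightarrow> 'a \<Rightarrow> 'a \<Rightarrow> 'a \<Rightarrow> bool" where
  "induced_P3 W p q r \<longleftrightarrow> {p, q, r} \<subseteq> W \<and> E p q \<and> E q r \<and> \<not> E p r \<and> p \<noteq> r"

text \<open>For an induced path \<open>p\<close>, \<open>q\<close>, \<open>r\<close> this says that
  \<open>a\<close>, \<open>p\<close>, \<open>q\<close>, \<open>r\<close>, \<open>b\<close> is an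
  induced path on five vertices; the distinctness not listed follows from the adjacencies. Demanding
  that \<open>a\<close> and \<open>b\<close> be nonadjacent is what tolerates 5-cycles.\<close>

definition extends_P3 :: "'a \<Rightarrow> 'a \<Rightarrow> 'a \<Rightarrow> 'a \<Rightarrow> 'a \<Rightarrow> bool" where
  "extends_P3 a p q r b \<longleftrightarrow> a \<noteq> b \<and> E a p \<and> E r b \<and>
     \<not> E a q \<and> \<not> E a r \<and> \<not> E a b \<and> \<not> E p b \<and> \<not> E q b"

text \<open>The simplicial paths of Chvatal, Rusu and Sritharan, for paths on three vertices.\<close>

definition simplicial_P3 :: "'a set \<Rightarrow> 'a \<Rightarrow> 'a \<Rightarrow> 'a \<Rightarrow> bool" where
  "simplicial_P3 W p q r \<longleftrightarrow> induced_P3 W p q r \<and> (\<forall>a\<in>W. \<forall>b\<in>W. \<not> extends_P3 a p q r b)"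

text \<open>Connectedness by growth along edges: adding a neighbour to a maximal set is then an
  introduction rule, and walks are obtained by induction.\<close>

inductive connected_in :: "'a set \<Rightarrow> 'a set \<Rightarrow> bool" for W where
  singleton: "v \<in> W \<Longrightarrow> connected_in W {v}"
| insert: "\<lbrakk>connected_in W B; v \<in> W; u \<in> B; E u v\<rbrakk> \<Longrightarrow> connected_in W (insert v B)"

definition walk_in :: "'a set \<Rightarrow> 'a list \<Rightarrow> bool" where
  "walk_in S xs \<longleftrightarrow> xs \<noteq> [] \<and> set xs \<subseteq> S \<and> (\<forall>i. Suc i < length xs \<longrightarrow> E (xs ! i) (xs ! Suc i))"

lemma connected_in_subset: "connected_in W B \<Longrightarrow> B \<subseteq> W \<and> B \<noteq> {}"
  by (induction rule: connected_in.induct) auto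

lemma walk_in_Cons: "walk_in S xs \<Longrightarrow> x \<in> S \<Longrightarrow> E x (hd xs) \<Longrightarrow> walk_in S (x # xs)"
  by (auto simp: walk_in_def nth_Cons hd_conv_nth split: nat.split)

lemma walk_in_rev: "walk_in S xs \<Longrightarrow> walk_in S (rev xs)"
  unfolding walk_in_def
proof (elim conjE, intro conjI allI impI)
  fix i assume *: "\<forall>i. Suc i < length xs \<longrightarrow> E (xs ! i) (xs ! Suc i)" and i: "Suc i < length (rev xs)"
  then have "Suc (length xs - Suc (Suc i)) = length xs - Suc i" "length xs - Suc i < length xs"
    by auto
  then have "E (xs ! (length xs - Suc (Suc i))) (xs ! (length xs - Suc i))"
    using * by metis
  then show "E (rev xs ! i) (rev xs ! Suc i)"
    using i by (auto simp: rev_nth intro: E_sym)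
qed auto

lemma walk_in_mono: "walk_in S xs \<Longrightarrow> S \<subseteq> T \<Longrightarrow> walk_in T xs"
  by (auto simp: walk_in_def)

lemma connected_in_walk:
  assumes "connected_in W B" "x \<in> B" "y \<in> B"
  shows "\<exists>xs. walk_in B xs \<and> hd xs = x \<and> last xs = y"
  using assms
proof (induction arbitrary: x y rule: connected_in.induct)
  case (singleton v)
  then show ?case
    by (intro exI[of _ "[v]"]) (simp add: walk_in_def)
next
  case (insert B v u)
  have from_v: "\<exists>xs. walk_in (insert v B) xs \<and> hd xs = v \<and> last xs = z" if z: "z \<in> B" for z
  proof -
    obtain xs where "walk_in B xs" "hd xs = u" "last xs = z"
      using insert.IH[OF insert.hyps(3) z] by blast
    then show ?thesis
      using walk_in_Cons[of "insert v B" xs v] walk_in_mono[of B xs "insert v B"] E_sym[OF insert.hyps(4)]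
      by (intro exI[of _ "v # xs"]) (auto simp: walk_in_def)
  qed
  consider "x \<in> B" "y \<in> B" | "x = v" "y \<in> B" | "x \<in> B" "y = v" | "x = v" "y = v"
    using insert.prems by blast
  then show ?case
  proof cases
    case 1
    then show ?thesis
      using insert.IH walk_in_mono[of B _ "insert v B"] by blast
  next
    case 2
    then show ?thesis
      using from_v by simp
  next
    case 3
    then obtain xs where "walk_in (insert v B) xs" "hd xs = v" "last xs = x"
      using from_v by blast
    then show ?thesis
      using 3 walk_in_rev by (intro exI[of _ "rev xs"]) (auto simp: walk_in_def hd_rev last_rev)
  next
    case 4
    then show ?thesis
      by (intro exI[of _ "[v]"]) (simp add: walk_in_def)
  qed
qed

text \<open>A shortest walk is an induced path, since a chord or a repetition would yield a shortcut.\<close>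

lemma walk_in_induced_path:
  assumes "walk_in S ys" "hd ys = x" "last ys = y"
  obtains xs where "walk_in S xs" "hd xs = x" "last xs = y" "distinct xs"
    "\<And>i j. i < j \<Longrightarrow> j < length xs \<Longrightarrow> E (xs ! i) (xs ! j) \<longleftrightarrow> j = Suc i"
proof -
  define P where "P xs \<longleftrightarrow> walk_in S xs \<and> hd xs = x \<and> last xs = y" for xs
  have "P ys"
    using assms by (simp add: P_def)
  then obtain xs where xs: "P xs" and min: "\<And>zs. P zs \<Longrightarrow> length xs \<le> length zs"
    using ex_has_least_nat[of P ys length] by blast
  have w: "xs \<noteq> []" "set xs \<subseteq> S" "\<And>i. Suc i < length xs \<Longrightarrow> E (xs ! i) (xs ! Suc i)"
    and ends: "hd xs = x" "last xs = y"
    using xs by (auto simp: P_def walk_in_def)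
  have shortcut: "P (take (Suc i) xs @ drop j xs)"
    if ij: "i < j" "j < length xs" and E: "E (xs ! i) (xs ! j)" for i j
    unfolding P_def walk_in_def
  proof (intro conjI allI impI)
    let ?zs = "take (Suc i) xs @ drop j xs"
    show "set ?zs \<subseteq> S"
      using w(2) by (auto dest: in_set_takeD in_set_dropD)
    show "hd ?zs = x" "last ?zs = y" "?zs \<noteq> []"
      using w(1) ends ij by auto
    fix k assume k: "Suc k < length ?zs"
    consider "k < i" | "k = i" | "i < k"
      by linarith
    then show "E (?zs ! k) (?zs ! Suc k)"
    proof cases
      case 1
      then show ?thesis
        using ij w(3)[of k] by (simp add: nth_append)
    next
      case 2
      then show ?thesis
        using ij E by (simp add: nth_append)
    next
      case 3
      then have "Suc (j + (k - Suc i)) < length xs" "Suc k - Suc i = Suc (k - Suc i)"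
        using k ij by auto
      then show ?thesis
        using 3 ij w(3)[of "j + (k - Suc i)"] by (simp add: nth_append)
    qed
  qed
  have E_iff: "E (xs ! i) (xs ! j) \<longleftrightarrow> j = Suc i" if ij: "i < j" "j < length xs" for i j
  proof
    assume "E (xs ! i) (xs ! j)"
    then show "j = Suc i"
      using min[OF shortcut[OF ij]] ij by simp
  qed (use w(3) ij in auto)
  have "xs ! i \<noteq> xs ! j" if ij: "i < j" "j < length xs" for i j
  proof
    assume eq: "xs ! i = xs ! j"
    \<comment> \<open>If the repeated vertex has a predecessor, that predecessor has a chord to
      position \<open>j\<close>. If it is the start, the tail beginning at \<open>j\<close> is
      already a shorter walk.\<close>
    show False
    proof (cases i)
      case (Suc k)
      then have "E (xs ! k) (xs ! j)"
        using w(3)[of k] ij eq by simp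
      then show False
        using E_iff[of k j] ij Suc by simp
    next
      case 0
      then have "P (drop j xs)"
        using w ends ij eq by (auto simp: P_def walk_in_def hd_drop_conv_nth hd_conv_nth dest: in_set_dropD)
      then show False
        using min[of "drop j xs"] ij by simp
    qed
  qed
  then have "distinct xs"
    unfolding distinct_conv_nth by (metis linorder_neqE_nat)
  then show thesis
    using that xs E_iff unfolding P_def by blast
qed

text \<open>A shortest path from \<open>a\<close> to \<open>b\<close> with interior in
  \<open>B\<close> is closed up by \<open>r\<close>, \<open>q\<close>, \<open>p\<close>. No vertex
  of \<open>B\<close> is adjacent to these three, so the only edges between them and the path are at
  \<open>a\<close> and \<open>b\<close>.\<close>

lemma induced_P3_closing_cycle:
  assumes B: "connected_in W B" and P3: "induced_P3 R p q r"
    and R: "\<And>x u. x \<in> R \<Longrightarrow> u \<in> B \<Longrightarrow> \<not> E u x \<and> x \<noteq> u"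
    and ext: "extends_P3 a p q r b"
    and a: "a \<notin> B" "ua \<in> B" "E ua a" and b: "b \<notin> B" "ub \<in> B" "E ub b"
  obtains xs where "induced_cycle xs" "6 \<le> length xs" "set xs \<subseteq> B \<union> {a, b, p, q, r}"
proof -
  obtain ys where ys: "walk_in B ys" "hd ys = ua" "last ys = ub"
    using connected_in_walk[OF B a(2) b(2)] by blast
  let ?S = "insert a (insert b B)"
  have "walk_in ?S ys"
    by (rule walk_in_mono[OF ys(1)]) auto
  then have "walk_in ?S (rev ys)" "hd (rev ys) = ub"
    using walk_in_rev ys by (auto simp: hd_rev)
  then have "walk_in ?S (b # rev ys)"
    using walk_in_Cons[of ?S "rev ys" b] E_sym[OF b(3)] by auto
  then have "walk_in ?S (rev (b # rev ys))" "hd (rev (b # rev ys)) = ua"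
    using walk_in_rev[of ?S "b # rev ys"] ys by (auto simp: walk_in_def hd_append)
  then have "walk_in ?S (a # ys @ [b])"
    using walk_in_Cons[of ?S "ys @ [b]" a] E_sym[OF a(3)] by auto
  then obtain xs where xs: "walk_in ?S xs" "hd xs = a" "last xs = b" "distinct xs"
    and E_xs: "\<And>i j. i < j \<Longrightarrow> j < length xs \<Longrightarrow> E (xs ! i) (xs ! j) \<longleftrightarrow> j = Suc i"
    using walk_in_induced_path[of ?S "a # ys @ [b]" a b] by auto
  have Pr: "p \<in> R" "q \<in> R" "r \<in> R" "E p q" "E q r" "\<not> E p r" "p \<noteq> r"
    using P3 by (auto simp: induced_P3_def)
  have ab: "a \<noteq> b" "E a p" "E r b" "\<not> E a q" "\<not> E a r" "\<not> E a b" "\<not> E p b" "\<not> E q b"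
    using ext by (auto simp: extends_P3_def)
  have ne: "xs \<noteq> []" and set_xs: "set xs \<subseteq> ?S"
    using xs(1) by (auto simp: walk_in_def)
  define m where "m = length xs"
  have xs0: "xs ! 0 = a" and xsm: "xs ! (m - 1) = b"
    using xs(2,3) ne by (simp_all add: hd_conv_nth last_conv_nth m_def)
  \<comment> \<open>Since \<open>a\<close> and \<open>b\<close> are distinct and nonadjacent, the
    path has an inner vertex. With \<open>p\<close>, \<open>q\<close>, \<open>r\<close> this makes
    at least 6 vertices.\<close>
  have m3: "3 \<le> m"
  proof (rule ccontr)
    assume "\<not> 3 \<le> m"
    then have "m - 1 = 0 \<or> m - 1 = 1 \<and> m = 2"
      using ne by (auto simp: m_def)
    then show False
      using xs0 xsm ab(1,6) E_xs[of 0 1] by (auto simp: m_def)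
  qed
  have inner: "xs ! i \<in> B" if "0 < i" "i < m - 1" for i
  proof -
    have "xs ! i \<noteq> a" "xs ! i \<noteq> b"
      using that xs(4) m3 ne nth_eq_iff_index_eq[OF xs(4), of i 0] nth_eq_iff_index_eq[OF xs(4), of i "m - 1"]
        xs0 xsm unfolding m_def by fastforce+
    moreover have "xs ! i \<in> set xs"
      using that by (simp add: m_def)
    ultimately show ?thesis
      using set_xs by blast
  qed
  have nB: "p \<notin> B" "q \<notin> B" "r \<notin> B"
    using R Pr by blast+
  have neq: "p \<noteq> q" "q \<noteq> r" "a \<noteq> p" "a \<noteq> q" "a \<noteq> r" "b \<noteq> p" "b \<noteq> q" "b \<noteq> r"
    using Pr ab E_irrefl E_sym by blast+
  let ?c = "xs @ [r, q, p]"
  have "distinct ?c"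
    using xs(4) set_xs nB neq Pr(7) by auto
  moreover have "E (?c ! i) (?c ! j) \<longleftrightarrow> j = Suc i \<or> i = 0 \<and> Suc j = length ?c"
    if ij: "i < j" "j < length ?c" for i j
  proof -
    have xsi: "i = 0 \<and> xs ! i = a \<or> i = m - 1 \<and> i \<noteq> 0 \<and> xs ! i = b \<or> 0 < i \<and> i < m - 1 \<and> xs ! i \<in> B"
      if im: "i < m"
    proof -
      consider "i = 0" | "i = m - 1" "i \<noteq> 0" | "0 < i" "i < m - 1"
        using im by linarith
      then show ?thesis
        using xs0 xsm inner by cases auto
    qed
    have no: "\<not> E u p" "\<not> E u q" "\<not> E u r" if "u \<in> B" for u
      using R Pr that by blast+
    have n: "length ?c = m + 3"
      by (simp add: m_def)
    consider (in_in) "j < m" | (in_out) "i < m" "j \<in> {m, m + 1, m + 2}" | (out_out) "m \<le> i"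
      using ij n by fastforce
    then show ?thesis
    proof cases
      case in_in
      then show ?thesis
        using E_xs[of i j] ij by (simp add: nth_append m_def)
    next
      case in_out
      have c: "?c ! i = xs ! i" "?c ! m = r" "?c ! (m + 1) = q" "?c ! (m + 2) = p"
        using in_out by (simp_all add: nth_append m_def)
      have "?c ! j = (if j = m then r else if j = m + 1 then q else p)"
        using in_out(2) c by auto
      moreover have "E b r" "\<not> E b q" "\<not> E b p"
        using ab E_sym by blast+
      ultimately show ?thesis
        using xsi[OF in_out(1)] in_out no ab m3 unfolding c(1) n by (auto split: if_splits)
    next
      case out_out
      have "E r q" "E q p" "\<not> E r p"
        using Pr E_sym by blast+
      moreover have "i = m \<and> j = m + 1 \<or> i = m \<and> j = m + 2 \<or> i = m + 1 \<and> j = m + 2"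
        using out_out ij n by linarith
      moreover have "?c ! m = r" "?c ! (m + 1) = q" "?c ! (m + 2) = p"
        by (simp_all add: nth_append m_def)
      ultimately show ?thesis
        using n m3 by auto
    qed
  qed
  ultimately have "induced_cycle ?c"
    using m3 unfolding induced_cycle_def m_def by auto
  then show thesis
    using that[of ?c] m3 set_xs by (auto simp: m_def)
qed

text \<open>
  Among the connected sets \<open>B\<close> whose non-neighbourhood still contains an induced \<open>P\<^sub>3\<close>, take a
  maximal one.  A path that is simplicial in the non-neighbourhood \<open>R\<close> of \<open>B\<close> is simplicial in the
  whole graph: if both ends of an extension are outside \<open>R\<close>, then a path through \<open>B\<close> closes it to a
  long induced cycle, and if only the end \<open>a\<close> is, then dropping \<open>a\<close> and its neighbour from the extension leaves
  an induced \<open>P\<^sub>3\<close> avoiding the neighbourhood of \<open>B \<union> {a}\<close>.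
\<close>

lemma simplicial_P3_exists:
  assumes "finite W" "induced_P3 W p q r"
    and "\<And>xs. induced_cycle xs \<Longrightarrow> set xs \<subseteq> W \<Longrightarrow> length xs < 6"
  shows "\<exists>p q r. simplicial_P3 W p q r"
  using assms
proof (induction "card W" arbitrary: W p q r rule: less_induct)
  case less
  define R where "R B = {x \<in> W. x \<notin> B \<and> (\<forall>u\<in>B. \<not> E u x)}" for B
  define \<B> where "\<B> = {B. connected_in W B \<and> (\<exists>p q r. induced_P3 (R B) p q r)}"
  have R_insert: "x \<in> R (insert a B) \<longleftrightarrow> x \<in> R B \<and> x \<noteq> a \<and> \<not> E a x" for x a B
    by (auto simp: R_def)
  have E_comm: "E u v \<longleftrightarrow> E v u" for u v
    using E_sym by blast
  show ?case
  proof (cases "\<B> = {}")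
    case True
    \<comment> \<open>The end \<open>q\<close>, \<open>r\<close>, \<open>b\<close> of an extension
      avoids \<open>a\<close> and its neighbours, so the singleton of \<open>a\<close> would belong
      to the empty family.\<close>
    have "\<not> extends_P3 a p q r b" if ab: "a \<in> W" "b \<in> W" for a b
    proof
      assume "extends_P3 a p q r b"
      then have "induced_P3 (R {a}) q r b"
        using less.prems(2) ab E_comm E_irrefl unfolding induced_P3_def extends_P3_def R_def by auto
      then have "{a} \<in> \<B>"
        using ab(1) connected_in.singleton by (auto simp: \<B>_def)
      with True show False
        by simp
    qed
    then have "simplicial_P3 W p q r"
      using less.prems(2) by (simp add: simplicial_P3_def)
    then show ?thesis
      by blast
  next
    case False
    have "\<B> \<subseteq> Pow W"
      using connected_in_subset by (auto simp: \<B>_def)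
    then have "finite \<B>"
      using less.prems(1) by (simp add: finite_subset)
    then obtain B where B: "B \<in> \<B>" and B_max: "\<And>C. C \<in> \<B> \<Longrightarrow> B \<subseteq> C \<Longrightarrow> B = C"
      using finite_has_maximal[OF _ False] by metis
    have conn: "connected_in W B" and "\<exists>p q r. induced_P3 (R B) p q r"
      using B by (auto simp: \<B>_def)
    then obtain p' q' r' where P3': "induced_P3 (R B) p' q' r'"
      by blast
    \<comment> \<open>Connected sets are nonempty, so \<open>R B\<close> is strictly smaller than
      \<open>W\<close> and the induction hypothesis applies to it.\<close>
    have RW: "R B \<subseteq> W" "R B \<noteq> W"
      using connected_in_subset[OF conn] by (auto simp: R_def)
    then have "card (R B) < card W"
      using less.prems(1) by (intro psubset_card_mono) auto
    moreover have "finite (R B)"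
      using RW(1) less.prems(1) by (rule finite_subset)
    ultimately obtain p q r where simp_R: "simplicial_P3 (R B) p q r"
      using less.hyps[of "R B" p' q' r'] P3' less.prems(3) RW(1) by (meson order_trans)
    then have P3: "induced_P3 (R B) p q r"
      by (simp add: simplicial_P3_def)
    have neighbour: "\<exists>u\<in>B. E u x" and x_notin: "x \<notin> B"
      if "x \<in> W" "x \<notin> R B" "y \<in> R B" "E x y" for x y
      using that by (auto simp: R_def)
    \<comment> \<open>Such an \<open>x\<close> has a neighbour in \<open>B\<close> without lying in
      it, so adding it keeps \<open>B\<close> connected. Maximality then forbids an induced path in
      what remains.\<close>
    have no_P3: "\<not> induced_P3 (R (insert x B)) s t u"
      if x: "x \<in> W" "x \<notin> R B" "y \<in> R B" "E x y" for x y s t u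
    proof
      assume "induced_P3 (R (insert x B)) s t u"
      moreover have "connected_in W (insert x B)"
        using neighbour[OF x] conn x(1) connected_in.insert by blast
      ultimately have "insert x B \<in> \<B>"
        by (auto simp: \<B>_def)
      then show False
        using B_max[of "insert x B"] x_notin[OF x] by blast
    qed
    have "\<not> extends_P3 a p q r b" if ab: "a \<in> W" "b \<in> W" for a b
    proof
      assume ext: "extends_P3 a p q r b"
      have mem: "p \<in> R B" "q \<in> R B" "r \<in> R B"
        using P3 by (auto simp: induced_P3_def)
      have Eap: "E a p" and Ebr: "E b r"
        using ext E_comm by (auto simp: extends_P3_def)
      consider "a \<in> R B" "b \<in> R B" | "a \<notin> R B" "b \<in> R B" | "a \<in> R B" "b \<notin> R B"
        | "a \<notin> R B" "b \<notin> R B"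
        by blast
      then show False
      proof cases
        case 1
        then show False
          using simp_R ext by (auto simp: simplicial_P3_def)
      next
        case 2
        have "induced_P3 (R (insert a B)) q r b"
          using P3 ext 2 E_comm E_irrefl unfolding induced_P3_def extends_P3_def by (auto simp: R_insert)
        then show False
          using no_P3[OF ab(1) 2(1) mem(1) Eap] by blast
      next
        case 3
        have "induced_P3 (R (insert b B)) a p q"
          using P3 ext 3 E_comm E_irrefl unfolding induced_P3_def extends_P3_def by (auto simp: R_insert)
        then show False
          using no_P3[OF ab(2) 3(2) mem(3) Ebr] by blast
      next
        case 4
        obtain ua ub where u: "ua \<in> B" "E ua a" "ub \<in> B" "E ub b"
          using neighbour[OF ab(1) 4(1) mem(1) Eap] neighbour[OF ab(2) 4(2) mem(3) Ebr] by blast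
        have "\<not> E u x \<and> x \<noteq> u" if "x \<in> R B" "u \<in> B" for x u
          using that by (auto simp: R_def)
        then obtain xs where xs: "induced_cycle xs" "6 \<le> length xs" "set xs \<subseteq> B \<union> {a, b, p, q, r}"
          using induced_P3_closing_cycle[OF conn P3 _ ext x_notin[OF ab(1) 4(1) mem(1) Eap] u(1,2)
              x_notin[OF ab(2) 4(2) mem(3) Ebr] u(3,4)] by blast
        then have "set xs \<subseteq> W"
          using connected_in_subset[OF conn] ab mem RW(1) by blast
        then show False
          using less.prems(3)[OF xs(1)] xs(2) by linarith
      qed
    qed
    then have "simplicial_P3 W p q r"
      using P3 RW(1) by (auto simp: simplicial_P3_def induced_P3_def)
    then show ?thesis
      by blast
  qed
qed

section \<open>Vertex decomposability of independence complexes\<close>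

text \<open>The independence complex of the subgraph induced on \<open>W\<close>. Deletion and link
  at a vertex stay in this family, which lets the induction run over \<open>W\<close>.\<close>

definition independent_subsets :: "'a set \<Rightarrow> 'a set set" where
  "independent_subsets W = {S. S \<subseteq> W \<and> (\<forall>u\<in>S. \<forall>v\<in>S. \<not> E u v)}"

lemma simplicial_complex_independent_subsets:
  assumes "finite W"
  shows "simplicial_complex (independent_subsets W)"
  unfolding simplicial_complex_def
proof (intro conjI ballI)
  show "finite (independent_subsets W)"
    by (rule finite_subset[of _ "Pow W"]) (auto simp: independent_subsets_def assms)
  show "independent_subsets W \<noteq> {}"
    by (auto simp: independent_subsets_def)
qed (use assms in \<open>auto simp: independent_subsets_def intro: finite_subset\<close>)

lemma deletion_independent_subsets:
  "deletion (independent_subsets W) v = independent_subsets (W - {v})"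
  by (auto simp: deletion_def independent_subsets_def)

lemma link_independent_subsets:
  assumes "v \<in> W"
  shows "link (independent_subsets W) {v} = independent_subsets (W - {u. u = v \<or> E v u})"
  using assms E_sym E_irrefl by (auto simp: link_def independent_subsets_def)

text \<open>The vertex \<open>w\<close> is outside \<open>S\<close> because it is adjacent to
  \<open>v\<close>. As \<open>S\<close> is maximal without \<open>v\<close>, adding \<open>w\<close>
  must destroy independence, so \<open>w\<close> has a neighbour in \<open>S\<close>.\<close>

lemma link_facet_neighbour:
  assumes S: "S \<in> link (independent_subsets W) {v}" "S \<in> facets (deletion (independent_subsets W) v)"
    and v: "v \<in> W" and w: "w \<in> W" "E v w"
  obtains z where "z \<in> S" "z \<in> W" "E w z" "\<not> E v z" "z \<noteq> v"
proof -
  have link: "S \<subseteq> W" "v \<notin> S" "\<forall>z\<in>S. \<not> E v z" and indep: "\<forall>x\<in>S. \<forall>y\<in>S. \<not> E x y"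
    using S(1) unfolding link_independent_subsets[OF v] by (auto simp: independent_subsets_def)
  have wS: "w \<notin> S" "w \<noteq> v"
    using link w E_irrefl by auto
  then have "insert w S \<notin> deletion (independent_subsets W) v"
    using S(2) by (auto simp: facets_def)
  then have "\<exists>z\<in>S. E w z"
    using wS link(1,2) indep w(1) E_irrefl
    unfolding deletion_independent_subsets by (auto simp: independent_subsets_def dest: E_sym)
  then show thesis
    using that link by blast
qed

text \<open>
  The middle vertex of a simplicial \<open>P\<^sub>3\<close> is a shedding vertex: a violating facet would contain a
  neighbour of each end, and in the absence of \<open>C\<^sub>4\<close> these extend the path.  Without an
  induced \<open>P\<^sub>3\<close>, every vertex of positive degree is a shedding vertex.
\<close>

lemma shedding_vertex_exists:
  assumes W: "finite W" and edge: "v0 \<in> W" "w0 \<in> W" "E v0 w0"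
    and cycles: "\<And>xs. induced_cycle xs \<Longrightarrow> set xs \<subseteq> W \<Longrightarrow> length xs = 3 \<or> length xs = 5"
  shows "\<exists>v\<in>W. link (independent_subsets W) {v} \<inter> facets (deletion (independent_subsets W) v) = {}"
proof (cases "\<exists>p q r. induced_P3 W p q r")
  case False
  have "S \<notin> facets (deletion (independent_subsets W) v0)" if S: "S \<in> link (independent_subsets W) {v0}" for S
  proof
    assume "S \<in> facets (deletion (independent_subsets W) v0)"
    then obtain z where "z \<in> W" "E w0 z" "\<not> E v0 z" "z \<noteq> v0"
      using link_facet_neighbour[OF S _ edge] by metis
    then have "induced_P3 W v0 w0 z"
      using edge by (auto simp: induced_P3_def)
    with False show False
      by blast
  qed
  then show ?thesis
    using edge(1) by blast
next
  case True
  then obtain p q r where simp_P3: "simplicial_P3 W p q r"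
    using simplicial_P3_exists[OF W] cycles by fastforce
  then have P3: "p \<in> W" "q \<in> W" "r \<in> W" "E p q" "E q r" "\<not> E p r" "p \<noteq> r"
    by (auto simp: simplicial_P3_def induced_P3_def)
  have E_comm: "E u v \<longleftrightarrow> E v u" for u v
    using E_sym by blast
  \<comment> \<open>A common neighbour of \<open>p\<close> and \<open>r\<close> that is not adjacent
    to \<open>q\<close> would close the path to an induced 4-cycle.\<close>
  have C4: False if x: "x \<in> W" "E x p" "E r x" "\<not> E q x" "x \<noteq> q" for x
  proof -
    let ?c = "[p, q, r, x]"
    have "distinct ?c"
      using P3 x E_irrefl by auto
    moreover have "E p x"
      using x(2) by (rule E_sym)
    then have "E (?c ! i) (?c ! j) \<longleftrightarrow> j = Suc i \<or> i = 0 \<and> Suc j = length ?c"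
      if "i < j" "j < length ?c" for i j
    proof -
      have "i = 0 \<and> j = 1 \<or> i = 0 \<and> j = 2 \<or> i = 0 \<and> j = 3 \<or> i = 1 \<and> j = 2 \<or> i = 1 \<and> j = 3 \<or> i = 2 \<and> j = 3"
        using that by auto
      then show ?thesis
        using P3 x(3,4) \<open>E p x\<close> by (elim disjE) simp_all
    qed
    ultimately have "induced_cycle ?c"
      unfolding induced_cycle_def by auto
    then show False
      using cycles[of ?c] P3 x by auto
  qed
  have "S \<notin> facets (deletion (independent_subsets W) q)" if S: "S \<in> link (independent_subsets W) {q}" for S
  proof
    assume facet: "S \<in> facets (deletion (independent_subsets W) q)"
    obtain a where a: "a \<in> S" "a \<in> W" "E p a" "\<not> E q a" "a \<noteq> q"
      using link_facet_neighbour[OF S facet P3(2,1)] P3(4) E_comm by metis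
    obtain b where b: "b \<in> S" "b \<in> W" "E r b" "\<not> E q b" "b \<noteq> q"
      using link_facet_neighbour[OF S facet P3(2,3,5)] by metis
    \<comment> \<open>Both vertices lie in the independent set \<open>S\<close>. The remaining
      requirements, including that \<open>a\<close> and \<open>b\<close> differ, come from the
      absence of a common neighbour as in \<open>C4\<close>.\<close>
    have "\<not> E a b"
      using S a(1) b(1) unfolding link_independent_subsets[OF P3(2)] by (auto simp: independent_subsets_def)
    moreover have "\<not> E a r" "\<not> E p b" "a \<noteq> b"
      using C4[of a] C4[of b] a b E_comm by blast+
    ultimately have "extends_P3 a p q r b"
      using a b E_comm by (auto simp: extends_P3_def)
    then show False
      using simp_P3 a(2) b(2) by (auto simp: simplicial_P3_def)
  qed
  then show ?thesis
    using P3(2) by blast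
qed

lemma independent_subsets_vertex_decomposable:
  assumes "finite W"
    and "\<And>xs. induced_cycle xs \<Longrightarrow> set xs \<subseteq> W \<Longrightarrow> length xs = 3 \<or> length xs = 5"
  shows "vertex_decomposable (independent_subsets W)"
  using assms
proof (induction "card W" arbitrary: W rule: less_induct)
  case less
  show ?case
  proof (cases "\<exists>v\<in>W. \<exists>w\<in>W. E v w")
    case False
    then have "independent_subsets W = Pow W"
      by (auto simp: independent_subsets_def)
    then show ?thesis
      using vertex_decomposable.simplex[OF less.prems(1)] by simp
  next
    case True
    then obtain v where v: "v \<in> W"
      "link (independent_subsets W) {v} \<inter> facets (deletion (independent_subsets W) v) = {}"
      using shedding_vertex_exists[OF less.prems(1)] less.prems(2) by metis
    have IH: "vertex_decomposable (independent_subsets U)" if "U \<subseteq> W" "v \<notin> U" for U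
      using less.hyps[of U] that less.prems psubset_card_mono[OF less.prems(1), of U] v(1)
        finite_subset[OF that(1)] by (metis order_trans psubsetI)
    show ?thesis
    proof (rule vertex_decomposable.shedding[of _ v])
      show "simplicial_complex (independent_subsets W)"
        by (rule simplicial_complex_independent_subsets[OF less.prems(1)])
      show "{v} \<in> independent_subsets W"
        using v(1) E_irrefl by (auto simp: independent_subsets_def)
      show "vertex_decomposable (deletion (independent_subsets W) v)"
        unfolding deletion_independent_subsets by (rule IH) auto
      show "vertex_decomposable (link (independent_subsets W) {v})"
        unfolding link_independent_subsets[OF v(1)] by (rule IH) auto
    qed fact
  qed
qed

end

theorem theorem1p1:
  fixes G :: "'a pair_pre_digraph"
  assumes "pair_graph G"
    and "\<And>W n. chordless_cycle G W n \<Longrightarrow> n = 3 \<or> n = 5"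
  shows "vertex_decomposable (independence_complex G) \<and>
    shellable (independence_complex G) \<and>
    sequentially_cohen_macaulay TYPE('k::field) (independence_complex G)"
proof -
  interpret pair_graph G by fact
  interpret simple_adjacency "\<lambda>u v. (u, v) \<in> parcs G"
  proof
    show "(v, u) \<in> parcs G" if "(u, v) \<in> parcs G" for u v
      using that pair_sym_arcs by (auto simp: symmetric_def sym_def)
    show "(u, u) \<notin> parcs G" for u
      using pair_no_loops[of "(u, u)"] by auto
  qed
  have "length xs = 3 \<or> length xs = 5" if "induced_cycle xs" "set xs \<subseteq> pverts G" for xs
    using that chordless_cycleI[OF assms(1), of xs] assms(2) unfolding induced_cycle_def by blast
  then have "vertex_decomposable (independent_subsets (pverts G))"
    using pair_finite_verts by (rule independent_subsets_vertex_decomposable[rotated])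
  moreover have "independent_subsets (pverts G) = independence_complex G"
    by (auto simp: independent_subsets_def independence_complex_def independent_set_def)
  ultimately show ?thesis
    using vertex_decomposable_shellable vertex_decomposable_sequentially_cohen_macaulay by metis
qed

end
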